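(* Let $X$ be an infinite-dimensional Fréchet space with a continuous norm, $Y$ a separable Fréchet space and $(T_n)_{n\ge 1}$ a sequence of continuous linear operators from $X$ to $Y$. If $(T_n)$ satisfies condition (C) for an increasing sequence $(n_k)$ of positive integers and if there exists an infinite-dimensional closed subspace $M_0$ of $X$ such that $T_{n_k}x\to 0$ as $k\to\infty$ for all $x\in M_0$, then $(T_n)$ possesses a hypercyclic subspace.
   Context: A sequence $(T_n)$ of continuous linear operators $X\to Y$ satisfies condition (C) for an increasing sequence $(n_k)$ of positive integers if there exists a dense subset $X_0\subset X$ such that (1) $T_{n_k}x\to 0$ for every $x\in X_0$; and (2) for every continuous seminorm $p$ on $X$, the set $\bigcup_k T_{n_k}(\{x\in X: p(x)<1\})$ is dense in $Y$. A vector $x\in X$ is hypercyclic for $(T_n)$ if $\{T_nx: n\ge 1\}$ is dense in $Y$. A hypercyclic subspace for $(T_n)$ is an infinite-dimensional closed linear subspace of $X$ in which every non-zero vector is hypercyclic for $(T_n)$. "With a continuous norm" means that there is a norm on $X$ that is continuous for the topology of $X$. Scalars are real or complex. *)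

theory Defs
  imports "HOL-Analysis.Analysis"
begin

text \<open>
  A topological vector space is a type carrying a topology, together with an explicit scalar
  multiplication \<open>scl\<close> over a normed field \<open>'k\<close>, so that real and complex scalars are treated
  alike. The sort of \<open>'k\<close> used in the main statement is that of a finite-dimensional
  commutative real algebra that is a field with multiplicative norm; up to isometric isomorphism,
  its members are exactly \<open>real\<close> and \<open>complex\<close>, which both are instances.
\<close>

definition seminorm :: "('k::real_normed_field \<Rightarrow> 'a::ab_group_add \<Rightarrow> 'a) \<Rightarrow> ('a \<Rightarrow> real) \<Rightarrow> bool" where
  "seminorm scl p \<longleftrightarrow>
     (\<forall>x. 0 \<le> p x) \<and>
     (\<forall>x y. p (x + y) \<le> p x + p y) \<and>
     (\<forall>a x. p (scl a x) = norm a * p x)"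

text \<open>
  The topology is the one induced by a separating increasing sequence of seminorms, and it
  is complete. Cauchy sequences for any compatible translation-invariant metric are
  the sequences that are Cauchy for each of the seminorms.
\<close>

definition frechet_space ::
    "('k::real_normed_field \<Rightarrow> 'a::{ab_group_add,topological_space} \<Rightarrow> 'a) \<Rightarrow> bool" where
  "frechet_space scl \<longleftrightarrow> vector_space scl \<and>
     (\<exists>p :: nat \<Rightarrow> 'a \<Rightarrow> real.
        (\<forall>n. seminorm scl (p n)) \<and>
        (\<forall>n x. p n x \<le> p (Suc n) x) \<and>
        (\<forall>x. (\<forall>n. p n x = 0) \<longrightarrow> x = 0) \<and>
        (\<forall>U. open U \<longleftrightarrow> (\<forall>x\<in>U. \<exists>n. \<exists>e>0. {y. p n (y - x) < e} \<subseteq> U)) \<and>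
        (\<forall>u :: nat \<Rightarrow> 'a.
           (\<forall>n. \<forall>e>0. \<exists>N. \<forall>i\<ge>N. \<forall>j\<ge>N. p n (u i - u j) < e) \<longrightarrow> (\<exists>l. u \<longlonglongrightarrow> l)))"

definition has_continuous_norm ::
    "('k::real_normed_field \<Rightarrow> 'a::{ab_group_add,topological_space} \<Rightarrow> 'a) \<Rightarrow> bool" where
  "has_continuous_norm scl \<longleftrightarrow>
     (\<exists>q. seminorm scl q \<and> (\<forall>x. q x = 0 \<longrightarrow> x = 0) \<and> continuous_on UNIV q)"

definition dense :: "'a::topological_space set \<Rightarrow> bool" where
  "dense S \<longleftrightarrow> closure S = UNIV"

definition infinite_dimensional ::
    "('k::real_normed_field \<Rightarrow> 'a::ab_group_add \<Rightarrow> 'a) \<Rightarrow> 'a set \<Rightarrow> bool" where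
  "infinite_dimensional scl S \<longleftrightarrow> \<not> (\<exists>B. finite B \<and> S \<subseteq> module.span scl B)"

definition condition_C ::
    "('k::real_normed_field \<Rightarrow> 'a::{ab_group_add,topological_space} \<Rightarrow> 'a) \<Rightarrow>
     (nat \<Rightarrow> 'a \<Rightarrow> 'b::{ab_group_add,topological_space}) \<Rightarrow> (nat \<Rightarrow> nat) \<Rightarrow> bool" where
  "condition_C scl T n \<longleftrightarrow>
     (\<exists>X0. dense X0 \<and> (\<forall>x\<in>X0. (\<lambda>k. T (n k) x) \<longlonglongrightarrow> 0)) \<and>
     (\<forall>p. seminorm scl p \<and> continuous_on UNIV p \<longrightarrow> dense (\<Union>k. T (n k) ` {x. p x < 1}))"

text \<open>
  A sequence of operators is a function on \<open>nat\<close> of which only the values at indices \<open>n \<ge> 1\<close> matter.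
\<close>

definition hypercyclic_vector ::
    "(nat \<Rightarrow> 'a \<Rightarrow> 'b::topological_space) \<Rightarrow> 'a \<Rightarrow> bool" where
  "hypercyclic_vector T x \<longleftrightarrow> dense {T n x | n. n \<ge> 1}"

definition hypercyclic_subspace ::
    "('k::real_normed_field \<Rightarrow> 'a::{ab_group_add,topological_space} \<Rightarrow> 'a) \<Rightarrow>
     (nat \<Rightarrow> 'a \<Rightarrow> 'b::topological_space) \<Rightarrow> 'a set \<Rightarrow> bool" where
  "hypercyclic_subspace scl T M \<longleftrightarrow>
     module.subspace scl M \<and> closed M \<and> infinite_dimensional scl M \<and>
     (\<forall>x\<in>M. x \<noteq> 0 \<longrightarrow> hypercyclic_vector T x)"

end

theory Submission
  imports Defs
begin

text \<open>
  Write \<open>S\<^sub>k\<close> for the operator with index \<open>n\<^sub>k\<close> and \<open>r\<close> for the continuous norm. Inside \<open>M\<^sub>0\<close> choose a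
  separable infinite-dimensional closed subspace \<open>U\<close>; by Hahn--Banach there are countably many
  functionals \<open>a\<^sub>m\<close>, dominated by \<open>r\<close>, which separate the points of \<open>U\<close>. Using condition (C), choose
  very small vectors \<open>w\<^sub>i\<close> in \<open>X\<^sub>0\<close> and indices \<open>\<kappa>\<^sub>i\<close> recursively such that \<open>S\<^bsub>\<kappa>\<^sub>i\<^esub> w\<^sub>i\<close> is close to a prescribed
  target, while \<open>S\<^bsub>\<kappa>\<^sub>i\<^esub> w\<^sub>l\<close> is negligible for \<open>l \<noteq> i\<close>. Each pair of an \<open>m\<close> and a member of a countable
  dense set of \<open>Y\<close> is treated at infinitely many stages \<open>i\<close>; let \<open>m\<^sub>i\<close> be the \<open>m\<close> of stage \<open>i\<close>.
  The map \<open>R x = x + (\<Sum>i. a\<^bsub>m\<^sub>i\<^esub> x \<cdot> w\<^sub>i)\<close> satisfies \<open>r x \<le> 2 r (R x)\<close>, which makes \<open>R\<close> injective with closed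
  range on closed subspaces. For \<open>x\<close> in \<open>U\<close> with \<open>a\<^sub>m x \<noteq> 0\<close> we have \<open>S\<^sub>k x \<rightarrow> 0\<close>, so \<open>S\<^bsub>\<kappa>\<^sub>i\<^esub> (R x)\<close> approaches
  \<open>a\<^sub>m x\<close> times each target along suitable stages. Hence \<open>R x\<close> is hypercyclic, and \<open>R U\<close> is the
  subspace sought.
\<close>

section \<open>Seminorms and functionals\<close>

locale normed_scalar_space = vector_space scl
  for scl :: "'k::real_normed_field \<Rightarrow> 'a::ab_group_add \<Rightarrow> 'a"
begin

section \<open>Basic inequalities for seminorms, and new seminorms from old ones\<close>

lemma seminorm_nonneg: "seminorm scl s \<Longrightarrow> 0 \<le> s x"
  and seminorm_add: "seminorm scl s \<Longrightarrow> s (x + y) \<le> s x + s y"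
  and seminorm_scale: "seminorm scl s \<Longrightarrow> s (scl c x) = norm c * s x"
  by (auto simp: seminorm_def)

lemma seminorm_zero: "seminorm scl s \<Longrightarrow> s 0 = 0"
  using seminorm_scale[of s 0 0] by simp

lemma seminorm_minus: "seminorm scl s \<Longrightarrow> s (- x) = s x"
  using seminorm_scale[of s "-1" x] by simp

lemma seminorm_diff: "seminorm scl s \<Longrightarrow> s (x - y) \<le> s x + s y"
  using seminorm_add[of s x "- y"] by (simp add: seminorm_minus)

lemma seminorm_commute: "seminorm scl s \<Longrightarrow> s (x - y) = s (y - x)"
  using seminorm_minus[of s "x - y"] by simp

lemma seminorm_triangle: "seminorm scl s \<Longrightarrow> s (x - z) \<le> s (x - y) + s (y - z)"
  using seminorm_add[of s "x - y" "y - z"] by simp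

lemma seminorm_sum: "seminorm scl s \<Longrightarrow> s (\<Sum>i\<in>I. f i) \<le> (\<Sum>i\<in>I. s (f i))"
proof (induction I rule: infinite_finite_induct)
  case (insert i I)
  then show ?case
    using seminorm_add[of s "f i" "sum f I"] by simp
qed (simp_all add: seminorm_zero)

lemma seminorm_plus:
  assumes s: "seminorm scl s" and t: "seminorm scl t"
  shows "seminorm scl (\<lambda>x. s x + t x)"
  unfolding seminorm_def
proof (intro conjI allI)
  show "0 \<le> s x + t x" for x
    by (intro add_nonneg_nonneg seminorm_nonneg s t)
  show "s (x + y) + t (x + y) \<le> s x + t x + (s y + t y)" for x y
    using seminorm_add[OF s, of x y] seminorm_add[OF t, of x y] by linarith
  show "s (scl c x) + t (scl c x) = norm c * (s x + t x)" for c x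
    by (simp only: seminorm_scale[OF s] seminorm_scale[OF t] distrib_left)
qed

lemma seminorm_times:
  assumes s: "seminorm scl s" and c: "0 \<le> c"
  shows "seminorm scl (\<lambda>x. c * s x)"
  unfolding seminorm_def
proof (intro conjI allI)
  show "0 \<le> c * s x" for x
    by (intro mult_nonneg_nonneg seminorm_nonneg s c)
  show "c * s (x + y) \<le> c * s x + c * s y" for x y
    using mult_left_mono[OF seminorm_add[OF s] c] by (simp only: distrib_left)
  show "c * s (scl d x) = norm d * (c * s x)" for d x
    by (simp only: seminorm_scale[OF s] mult_ac)
qed

lemma seminorm_sum_seminorms:
  assumes "\<And>i. seminorm scl (f i)"
  shows "seminorm scl (\<lambda>x. \<Sum>i\<in>I. f i x)"
proof (induction I rule: infinite_finite_induct)
  case (insert i I)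
  then show ?case
    using seminorm_plus[OF assms[of i] insert.IH] by simp
qed (simp_all add: seminorm_def)

section \<open>Sublinear functionals and a real Hahn--Banach theorem\<close>

definition sublinear :: "('a \<Rightarrow> real) \<Rightarrow> bool" where
  "sublinear g \<longleftrightarrow> (\<forall>x y. g (x + y) \<le> g x + g y) \<and>
     (\<forall>t\<ge>0. \<forall>x. g (scl (of_real t) x) \<le> t * g x)"

lemma sublinear_add: "sublinear g \<Longrightarrow> g (x + y) \<le> g x + g y"
  and sublinear_scale_le: "sublinear g \<Longrightarrow> 0 \<le> t \<Longrightarrow> g (scl (of_real t) x) \<le> t * g x"
  by (auto simp: sublinear_def)

lemma sublinear_zero: "sublinear g \<Longrightarrow> g 0 = 0"
  using sublinear_scale_le[of g 0 0] sublinear_add[of g 0 0] by simp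

text \<open>For positive \<open>t\<close> the defining inequality, applied with factor
  \<open>1 / t\<close>, yields the converse inequality.\<close>

lemma sublinear_scale:
  assumes "sublinear g" "0 \<le> t"
  shows "g (scl (of_real t) x) = t * g x"
proof (cases "t = 0")
  case False
  with assms have "t > 0" by simp
  have "g (scl (of_real (1 / t)) (scl (of_real t) x)) \<le> (1 / t) * g (scl (of_real t) x)"
    using assms by (intro sublinear_scale_le) auto
  moreover have "scl (of_real (1 / t)) (scl (of_real t) x) = x"
    using False by simp
  ultimately have "g x \<le> g (scl (of_real t) x) / t"
    by simp
  with \<open>t > 0\<close> have "t * g x \<le> g (scl (of_real t) x)"
    by (simp add: field_simps)
  with sublinear_scale_le[OF assms] show ?thesis
    by (intro antisym) auto
qed (use assms in \<open>simp add: sublinear_zero\<close>)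

text \<open>Used to bound chains of sublinear functionals from below, so that their pointwise infima
  exist.\<close>

lemma sublinear_minus_ge: "sublinear g \<Longrightarrow> - g (- x) \<le> g x"
  using sublinear_add[of g x "- x"] by (simp add: sublinear_zero)

lemma seminorm_imp_sublinear: "seminorm scl s \<Longrightarrow> sublinear s"
  by (simp add: sublinear_def seminorm_add seminorm_scale)

text \<open>For a minimal sublinear \<open>g\<close> the lemma gives \<open>h = g\<close>, hence \<open>g y + g x \<le> g (y + x)\<close>:
  minimal sublinear functionals are additive.\<close>

lemma sublinear_tilt:
  assumes g: "sublinear g"
  obtains h where "sublinear h" "\<And>y. h y \<le> g y" "\<And>y. h y \<le> g (y + x) - g x"
proof -
  \<comment> \<open>The value \<open>t = 0\<close> will give \<open>h \<le> g\<close> and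
    \<open>t = 1\<close> the tilted bound; taking the infimum over all \<open>t \<ge> 0\<close>
    makes \<open>h\<close> sublinear.\<close>
  define G where "G = (\<lambda>y t. g (y + scl (of_real t) x) - t * g x)"
  define h where "h = (\<lambda>y. INF t\<in>{0..}. G y t)"
  have lower: "- g (- y) \<le> G y t" if "t \<ge> 0" for y t
  proof -
    have "t * g x = g ((y + scl (of_real t) x) + (- y))"
      using that g by (simp add: sublinear_scale)
    also have "\<dots> \<le> g (y + scl (of_real t) x) + g (- y)"
      by (rule sublinear_add[OF g])
    finally show ?thesis by (simp add: G_def)
  qed
  have bdd: "bdd_below (G y ` {0..})" for y
    by (rule bdd_belowI2[of _ "- g (- y)"]) (use lower in auto)
  have h_le: "h y \<le> G y t" if "t \<ge> 0" for y t
    unfolding h_def using that by (intro cINF_lower bdd) auto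
  have h_ge: "c \<le> h y" if "\<And>t. t \<ge> 0 \<Longrightarrow> c \<le> G y t" for c y
    unfolding h_def using that by (intro cINF_greatest) auto
  have "h (y + z) \<le> h y + h z" for y z
  proof -
    \<comment> \<open>Parameters add: \<open>t\<close> for \<open>y\<close> and \<open>s\<close> for
      \<open>z\<close> are matched by \<open>t + s\<close> for \<open>y + z\<close>.\<close>
    have "h (y + z) \<le> G y t + G z s" if "t \<ge> 0" "s \<ge> 0" for t s
    proof -
      have "h (y + z) \<le> G (y + z) (t + s)"
        using that by (intro h_le) auto
      also have "\<dots> \<le> G y t + G z s"
        using sublinear_add[OF g, of "y + scl (of_real t) x" "z + scl (of_real s) x"]
        by (simp add: G_def scale_left_distrib algebra_simps)
      finally show ?thesis .
    qed
    then have "h (y + z) - G y t \<le> h z" if "t \<ge> 0" for t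
      using that by (intro h_ge) (simp add: algebra_simps)
    then have "h (y + z) - h z \<le> h y"
      by (intro h_ge) (simp add: algebra_simps)
    then show ?thesis by simp
  qed
  moreover have "h (scl (of_real r) y) \<le> r * h y" if "r \<ge> 0" for r y
  proof (cases "r = 0")
    case True
    then show ?thesis
      using h_le[of 0 0] by (simp add: G_def sublinear_zero[OF g])
  next
    case False
    with that have "r > 0" by simp
    \<comment> \<open>Parameters scale: \<open>t\<close> for \<open>y\<close> is matched by
      \<open>r * t\<close> for the vector multiplied by \<open>r\<close>.\<close>
    have "h (scl (of_real r) y) / r \<le> G y t" if "t \<ge> 0" for t
    proof -
      have "h (scl (of_real r) y) \<le> G (scl (of_real r) y) (r * t)"
        using that \<open>r > 0\<close> by (intro h_le) auto
      also have "\<dots> = g (scl (of_real r) (y + scl (of_real t) x)) - r * t * g x"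
        by (simp add: G_def scale_right_distrib)
      also have "\<dots> = r * G y t"
        using \<open>r > 0\<close> sublinear_scale[OF g, of r "y + scl (of_real t) x"]
        by (simp only: G_def) (simp add: right_diff_distrib)
      finally show ?thesis
        using \<open>r > 0\<close> by (simp add: field_simps)
    qed
    then have "h (scl (of_real r) y) / r \<le> h y"
      by (rule h_ge)
    then show ?thesis
      using \<open>r > 0\<close> by (simp add: field_simps)
  qed
  ultimately have "sublinear h"
    by (simp add: sublinear_def)
  moreover have "h y \<le> g y" for y
    using h_le[of 0 y] by (simp add: G_def)
  moreover have "h y \<le> g (y + x) - g x" for y
    using h_le[of 1 y] by (simp add: G_def)
  ultimately show ?thesis by (rule that)
qed

lemma minimal_sublinear_exists:
  assumes g: "sublinear g"
  obtains f where "sublinear f" "\<And>x. f x \<le> g x"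
    "\<And>h. sublinear h \<Longrightarrow> (\<And>x. h x \<le> f x) \<Longrightarrow> h = f"
proof -
  define A where "A = {h. sublinear h \<and> h \<le> g}"
  \<comment> \<open>The order is reversed, so that the upper bounds required by Zorn's lemma are
    lower bounds of functionals: \<open>g\<close> for the empty chain, the pointwise infimum
    otherwise.\<close>
  define P where "P = (\<lambda>(h::'a \<Rightarrow> real) h'. h' \<le> h)"
  have "\<exists>f\<in>A. \<forall>h\<in>A. P f h \<longrightarrow> h = f"
  proof (rule predicate_Zorn)
    show "partial_order_on A (relation_of P A)"
      by (rule partial_order_on_relation_ofI) (auto simp: P_def)
  next
    fix C assume C: "C \<in> Chains (relation_of P A)"
    then have CA: "C \<subseteq> A" and chain: "\<And>h k. h \<in> C \<Longrightarrow> k \<in> C \<Longrightarrow> h \<le> k \<or> k \<le> h"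
      by (auto simp: Chains_def relation_of_def P_def)
    show "\<exists>u\<in>A. \<forall>h\<in>C. P h u"
    proof (cases "C = {}")
      case True
      then show ?thesis using g by (auto simp: A_def)
    next
      case False
      have sub: "sublinear h" "h x \<le> g x" if "h \<in> C" for h x
        using that CA by (auto simp: A_def le_fun_def)
      define u where "u = (\<lambda>x. INF h\<in>C. h x)"
      have bdd: "bdd_below ((\<lambda>h. h x) ` C)" for x
      proof (rule bdd_belowI2)
        fix h assume "h \<in> C"
        then show "- g (- x) \<le> h x"
          using sublinear_minus_ge[OF sub(1), of h x] sub(2)[of h "- x"] by linarith
      qed
      have u_le: "u x \<le> h x" if "h \<in> C" for h x
        unfolding u_def using that by (intro cINF_lower bdd)
      have u_ge: "c \<le> u x" if "\<And>h. h \<in> C \<Longrightarrow> c \<le> h x" for c x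
        unfolding u_def using that False by (intro cINF_greatest) auto
      have "u (x + y) \<le> u x + u y" for x y
      proof -
        \<comment> \<open>Both members of the chain dominate the smaller of the two, and
          subadditivity of that single functional suffices.\<close>
        have *: "u (x + y) \<le> h x + k y" if hk: "h \<in> C" "k \<in> C" for h k
        proof -
          from chain[OF hk] obtain m where m: "m \<in> C" "m \<le> h" "m \<le> k"
            using hk by blast
          have "u (x + y) \<le> m x + m y"
            using u_le[OF m(1), of "x + y"] sublinear_add[OF sub(1)[OF m(1)], of x y] by linarith
          also have "\<dots> \<le> h x + k y"
            using m by (intro add_mono) (auto simp: le_fun_def)
          finally show ?thesis .
        qed
        have "u (x + y) - h x \<le> u y" if h: "h \<in> C" for h
        proof (rule u_ge)
          fix k assume "k \<in> C"
          from *[OF h this] show "u (x + y) - h x \<le> k y"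
            by simp
        qed
        then have "u (x + y) - u y \<le> u x"
          by (intro u_ge) (simp add: algebra_simps)
        then show ?thesis by simp
      qed
      moreover have "u (scl (of_real t) x) \<le> t * u x" if "t \<ge> 0" for t x
      proof (cases "t = 0")
        case True
        from False obtain h where "h \<in> C" by blast
        then show ?thesis
          using True u_le[of h 0] sublinear_zero[OF sub(1), of h] by simp
      next
        case nz: False
        have "u (scl (of_real t) x) / t \<le> h x" if "h \<in> C" for h
          using u_le[OF that, of "scl (of_real t) x"] sublinear_scale[OF sub(1)[OF that], of t x]
            \<open>t \<ge> 0\<close> nz by (simp add: field_simps)
        then have "u (scl (of_real t) x) / t \<le> u x"
          by (rule u_ge)
        then show ?thesis
          using \<open>t \<ge> 0\<close> nz by (simp add: field_simps)
      qed
      ultimately have "sublinear u"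
        by (simp add: sublinear_def)
      moreover from False obtain h where "h \<in> C" by blast
      then have "u \<le> g"
        using u_le[of h] sub(2)[of h] by (auto simp: le_fun_def intro: order_trans)
      ultimately have "u \<in> A"
        by (simp add: A_def)
      then show ?thesis
        using u_le by (auto simp: P_def le_fun_def)
    qed
  qed
  then obtain f where f: "f \<in> A" and min: "\<And>h. h \<in> A \<Longrightarrow> h \<le> f \<Longrightarrow> h = f"
    by (auto simp: P_def)
  show ?thesis
  proof (rule that[of f])
    show "sublinear f" "f x \<le> g x" for x
      using f by (auto simp: A_def le_fun_def)
    show "h = f" if "sublinear h" "\<And>x. h x \<le> f x" for h
      using f that by (intro min) (auto simp: A_def le_fun_def intro: order_trans)
  qed
qed

text \<open>Tilting \<open>s\<close> by \<open>d\<close> before minimizing forces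
  \<open>f (- d) \<le> s 0 - s d = - s d\<close>, which is the norming property at \<open>d\<close>.
  Minimality makes \<open>f\<close> additive, since tilting \<open>f\<close> by any vector leaves it
  unchanged.\<close>

lemma real_Hahn_Banach_point:
  assumes s: "seminorm scl s"
  obtains f where "\<And>x y. f (x + y) = f x + f y" "\<And>t x. f (scl (of_real t) x) = t * f x"
    "\<And>x. f x \<le> s x" "s d \<le> f d"
proof -
  have sub: "sublinear s"
    by (rule seminorm_imp_sublinear[OF s])
  obtain g where g: "sublinear g" "\<And>y. g y \<le> s y" "\<And>y. g y \<le> s (y + d) - s d"
    using sublinear_tilt[OF sub] by metis
  obtain f where f: "sublinear f" "\<And>x. f x \<le> g x"
    and min: "\<And>h. sublinear h \<Longrightarrow> (\<And>x. h x \<le> f x) \<Longrightarrow> h = f"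
    using minimal_sublinear_exists[OF g(1)] by metis
  have add: "f (x + y) = f x + f y" for x y
  proof (rule antisym)
    obtain h where h: "sublinear h" "\<And>z. h z \<le> f z" "\<And>z. h z \<le> f (z + y) - f y"
      using sublinear_tilt[OF f(1)] by metis
    with min[OF h(1,2)] have "f x \<le> f (x + y) - f y" by metis
    then show "f x + f y \<le> f (x + y)" by simp
  qed (rule sublinear_add[OF f(1)])
  have minus: "f (- x) = - f x" for x
    using add[of x "- x"] sublinear_zero[OF f(1)] by simp
  show ?thesis
  proof (rule that[of f, OF add])
    show "f (scl (of_real t) x) = t * f x" for t x
    proof (cases "t \<ge> 0")
      case False
      then have "f (scl (of_real (- t)) x) = - t * f x"
        by (intro sublinear_scale[OF f(1)]) simp
      then show ?thesis by (simp add: minus)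
    qed (rule sublinear_scale[OF f(1)])
    show "f x \<le> s x" for x
      using f(2)[of x] g(2)[of x] by linarith
    have "f (- d) \<le> - s d"
      using f(2)[of "- d"] g(3)[of "- d"] sublinear_zero[OF sub] by simp
    then show "s d \<le> f d" by (simp add: minus)
  qed
qed

end

text \<open>Replaces the passage from a real functional \<open>f\<close> to \<open>f x - \<i> f (\<i> x)\<close>: the scalar functional
  sends \<open>x\<close> to the element representing \<open>c \<mapsto> f (c x)\<close> via the trace form \<open>(a, c) \<mapsto> (a * c) \<bullet> 1\<close>.\<close>

lemma trace_form_represents:
  fixes \<phi> :: "'k::{real_normed_field,euclidean_space} \<Rightarrow> real"
  assumes "linear \<phi>"
  shows "\<exists>!a. \<forall>c. (a * c) \<bullet> 1 = \<phi> c"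
proof -
  \<comment> \<open>\<open>L a\<close> lists the values of the form at the basis vectors.
    Injectivity of this linear map suffices: in finite dimension it implies surjectivity, and a
    preimage of the coordinate vector of \<open>\<phi>\<close> represents
    \<open>\<phi>\<close>.\<close>
  define L where "L = (\<lambda>a::'k. \<Sum>b\<in>Basis. ((a * b) \<bullet> 1) *\<^sub>R b)"
  have L_inner: "L a \<bullet> b = (a * b) \<bullet> 1" if "b \<in> Basis" for a b
    using that by (simp add: L_def inner_sum_left inner_Basis if_distrib sum.delta cong: if_cong)
  have "linear L"
    by (rule linearI) (simp_all add: L_def algebra_simps inner_add_left sum.distrib scaleR_sum_right)
  have form: "linear (\<lambda>c. (a * c) \<bullet> 1)" for a :: 'k
    by (rule linearI) (simp_all add: algebra_simps inner_add_left)
  have zero: "a = 0" if "\<And>c. (a * c) \<bullet> 1 = 0" for a :: 'k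
  proof (rule ccontr)
    assume "a \<noteq> 0"
    \<comment> \<open>The choice \<open>c = inverse a\<close> gives \<open>1 \<bullet> 1\<close>,
      which is nonzero.\<close>
    then show False
      using that[of "inverse a"] by simp
  qed
  have ext: "(a * c) \<bullet> 1 = \<phi> c" if "\<And>b. b \<in> Basis \<Longrightarrow> (a * b) \<bullet> 1 = \<phi> b" for a c
    using linear_eq_on_span[OF form assms, of Basis a c] that by simp
  have "inj L"
  proof (subst linear_injective_0[OF \<open>linear L\<close>], intro allI impI zero)
    fix a c assume "L a = 0"
    then have "(a * b) \<bullet> 1 = 0" if "b \<in> Basis" for b
      using L_inner[OF that, of a] by simp
    then show "(a * c) \<bullet> 1 = 0"
      using linear_eq_on_span[OF form linear_zero, of Basis a c] by simp
  qed
  then have "surj L"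
    by (rule eucl.linear_inj_imp_surj[OF \<open>linear L\<close>])
  then obtain a where a: "L a = (\<Sum>b\<in>Basis. \<phi> b *\<^sub>R b)"
    by (metis surjD)
  have "(a * b) \<bullet> 1 = \<phi> b" if "b \<in> Basis" for b
    using that by (simp add: L_inner[symmetric] a inner_sum_left inner_Basis if_distrib sum.delta
        cong: if_cong)
  then have "(a * c) \<bullet> 1 = \<phi> c" for c
    by (rule ext)
  moreover have "a' = a" if "\<forall>c. (a' * c) \<bullet> 1 = \<phi> c" for a'
    using zero[of "a' - a"] that calculation by (simp add: left_diff_distrib inner_diff_left)
  ultimately show ?thesis by blast
qed

text \<open>Uniqueness of the representing element makes \<open>a\<close> linear over the scalars.
  Rescaling \<open>x\<close> by \<open>inverse (a x)\<close> makes the trace form equal to 1, and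
  \<open>f \<le> s\<close> then bounds \<open>norm (a x)\<close>. Cauchy--Schwarz against 1
  transfers the norming property from \<open>f\<close> to \<open>a\<close>.\<close>

lemma Hahn_Banach_point:
  fixes scl :: "'k::{real_normed_field,euclidean_space} \<Rightarrow> 'a::ab_group_add \<Rightarrow> 'a"
  assumes "vector_space scl" and s: "seminorm scl s"
  obtains a where "\<And>x y. a (x + y) = a x + a y" "\<And>c x. a (scl c x) = c * a x"
    "\<And>x. norm (a x) \<le> s x" "s d \<le> norm (a d)"
proof -
  interpret vector_space scl by fact
  interpret normed_scalar_space scl ..
  obtain f where f_add: "\<And>x y. f (x + y) = f x + f y"
    and f_scale: "\<And>t x. f (scl (of_real t) x) = t * f x"
    and f_le: "\<And>x. f x \<le> s x" and f_d: "s d \<le> f d"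
    using real_Hahn_Banach_point[OF s] by metis
  have lin: "linear (\<lambda>c. f (scl c x))" for x
  proof (rule linearI)
    show "f (scl (b + c) x) = f (scl b x) + f (scl c x)" for b c
      by (simp add: scale_left_distrib f_add)
    show "f (scl (r *\<^sub>R c) x) = r *\<^sub>R f (scl c x)" for r c
      using f_scale[of r "scl c x"] by (simp add: scaleR_conv_of_real)
  qed
  define a where "a = (\<lambda>x. THE a. \<forall>c. (a * c) \<bullet> 1 = f (scl c x))"
  have a: "(a x * c) \<bullet> 1 = f (scl c x)" for x c
    using theI'[OF trace_form_represents[OF lin[of x]]] by (simp add: a_def)
  have a_unique: "a x = b" if "\<And>c. (b * c) \<bullet> 1 = f (scl c x)" for x b
    using trace_form_represents[OF lin[of x]] a that by blast
  show ?thesis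
  proof (rule that[of a])
    show "a (x + y) = a x + a y" for x y
      by (rule a_unique) (simp add: distrib_right inner_add_left a scale_right_distrib f_add)
    show "a (scl c x) = c * a x" for c x
    proof (rule a_unique)
      fix b
      have "(c * a x * b) \<bullet> 1 = (a x * (b * c)) \<bullet> 1" by (simp add: mult_ac)
      then show "(c * a x * b) \<bullet> 1 = f (scl b (scl c x))" by (simp add: a)
    qed
    show "norm (a x) \<le> s x" for x
    proof (cases "a x = 0")
      case False
      have "1 = (a x * inverse (a x)) \<bullet> 1"
        using False by (simp add: dot_square_norm)
      also have "\<dots> = f (scl (inverse (a x)) x)" by (rule a)
      also have "\<dots> \<le> s (scl (inverse (a x)) x)" by (rule f_le)
      also have "\<dots> = s x / norm (a x)"
        by (simp add: seminorm_scale[OF s] norm_inverse divide_inverse mult.commute)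
      finally show ?thesis using False by (simp add: field_simps)
    qed (simp add: seminorm_nonneg[OF s])
    have "f d = (a d * 1) \<bullet> 1" by (simp only: a scale_one)
    also have "\<dots> \<le> norm (a d)"
      using norm_cauchy_schwarz[of "a d" 1] by simp
    finally show "s d \<le> norm (a d)" using f_d by simp
  qed
qed

section \<open>Sequences and closures in Frechet spaces\<close>

text \<open>A telescoping geometric sum. With the shift by 2 in the exponent the whole series stays
  below 1/2, the contraction factor needed for \<open>K\<close> later.\<close>

lemma sum_half_powers:
  assumes "N \<le> (M::nat)"
  shows "(\<Sum>i\<in>{N..<M}. (1/2::real) ^ (i + 2)) \<le> (1/2) ^ (N + 1)"
proof -
  have "(\<Sum>i\<in>{N..<M}. (1/2::real) ^ (i + 2)) = (1/2) ^ (N + 1) - (1/2) ^ (M + 1)"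
    using assms
  proof (induction M rule: dec_induct)
    case (step n)
    then show ?case by simp
  qed simp
  then show ?thesis by simp
qed

locale seminormed_frechet = normed_scalar_space scl
  for scl :: "'k::real_normed_field \<Rightarrow> 'a::{ab_group_add,topological_space} \<Rightarrow> 'a" +
  fixes p :: "nat \<Rightarrow> 'a \<Rightarrow> real"
  assumes p: "seminorm scl (p n)"
    and p_Suc: "p n x \<le> p (Suc n) x"
    and p_separating: "(\<And>n. p n x = 0) \<Longrightarrow> x = 0"
    and open_iff: "open U \<longleftrightarrow> (\<forall>x\<in>U. \<exists>n. \<exists>e>0. {y. p n (y - x) < e} \<subseteq> U)"
    and p_complete: "(\<And>n e. e > 0 \<Longrightarrow> \<exists>N. \<forall>i\<ge>N. \<forall>j\<ge>N. p n (u i - u j) < e) \<Longrightarrow>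
      \<exists>l. u \<longlonglongrightarrow> l"
begin

section \<open>Limits and closures expressed through the seminorms\<close>

lemma p_mono: "m \<le> n \<Longrightarrow> p m x \<le> p n x"
  by (induction rule: dec_induct) (auto intro: order_trans p_Suc)

lemma open_ball: "open {y. p n (y - x) < e}"
  unfolding open_iff
proof
  fix y assume y: "y \<in> {y. p n (y - x) < e}"
  have "{z. p n (z - y) < e - p n (y - x)} \<subseteq> {y. p n (y - x) < e}"
    using seminorm_triangle[OF p, of n _ x y] by (smt (verit) mem_Collect_eq subsetI)
  with y show "\<exists>m. \<exists>d>0. {z. p m (z - y) < d} \<subseteq> {y. p n (y - x) < e}"
    by (intro exI[of _ n] exI[of _ "e - p n (y - x)"]) auto
qed

lemma tendsto_iff_p:
  fixes u :: "nat \<Rightarrow> 'a"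
  shows "u \<longlonglongrightarrow> l \<longleftrightarrow> (\<forall>n. (\<lambda>i. p n (u i - l)) \<longlonglongrightarrow> 0)"
proof
  assume u: "u \<longlonglongrightarrow> l"
  show "\<forall>n. (\<lambda>i. p n (u i - l)) \<longlonglongrightarrow> 0"
  proof (intro allI tendstoI)
    fix n and e :: real assume "e > 0"
    then have "l \<in> {y. p n (y - l) < e}"
      by (simp add: seminorm_zero[OF p])
    with topological_tendstoD[OF u open_ball]
    have "\<forall>\<^sub>F i in sequentially. u i \<in> {y. p n (y - l) < e}"
      by blast
    then show "\<forall>\<^sub>F i in sequentially. dist (p n (u i - l)) 0 < e"
      by eventually_elim (simp add: seminorm_nonneg[OF p])
  qed
next
  assume u: "\<forall>n. (\<lambda>i. p n (u i - l)) \<longlonglongrightarrow> 0"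
  show "u \<longlonglongrightarrow> l"
  proof (rule topological_tendstoI)
    fix U assume "open U" "l \<in> U"
    then obtain n e where "e > 0" and sub: "{y. p n (y - l) < e} \<subseteq> U"
      unfolding open_iff by blast
    with u have "\<forall>\<^sub>F i in sequentially. p n (u i - l) < e"
      by (intro order_tendstoD(2)[of _ 0]) auto
    then show "\<forall>\<^sub>F i in sequentially. u i \<in> U"
      by eventually_elim (use sub in auto)
  qed
qed

text \<open>The type class carries no separation axiom; uniqueness of limits comes from the
  seminorms separating points.\<close>

lemma tendsto_unique_p:
  fixes u :: "nat \<Rightarrow> 'a"
  assumes "u \<longlonglongrightarrow> l" "u \<longlonglongrightarrow> l'"
  shows "l = l'"
proof -
  have "p n (l - l') = 0" for n
  proof -
    have "(\<lambda>i. p n (u i - l) + p n (u i - l')) \<longlonglongrightarrow> 0 + 0"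
      using assms unfolding tendsto_iff_p by (intro tendsto_add) auto
    moreover have "p n (l - l') \<le> p n (u i - l) + p n (u i - l')" for i
      using seminorm_triangle[OF p, of n l l' "u i"] seminorm_commute[OF p, of n l "u i"] by simp
    ultimately have "p n (l - l') \<le> 0 + 0"
      by (intro LIMSEQ_le_const) auto
    then show ?thesis
      using seminorm_nonneg[OF p, of n "l - l'"] by simp
  qed
  then show ?thesis
    using p_separating[of "l - l'"] by simp
qed

lemma tendsto_add_p:
  fixes u v :: "nat \<Rightarrow> 'a"
  assumes "u \<longlonglongrightarrow> l" "v \<longlonglongrightarrow> m"
  shows "(\<lambda>i. u i + v i) \<longlonglongrightarrow> l + m"
  unfolding tendsto_iff_p
proof
  fix n
  show "(\<lambda>i. p n (u i + v i - (l + m))) \<longlonglongrightarrow> 0"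
  proof (rule real_tendsto_sandwich[OF always_eventually always_eventually])
    show "\<forall>i. 0 \<le> p n (u i + v i - (l + m))"
      by (simp add: seminorm_nonneg[OF p])
    show "\<forall>i. p n (u i + v i - (l + m)) \<le> p n (u i - l) + p n (v i - m)"
      using seminorm_add[OF p, of n "u _ - l" "v _ - m"] by (simp add: algebra_simps)
    have "(\<lambda>i. p n (u i - l) + p n (v i - m)) \<longlonglongrightarrow> 0 + 0"
      using assms unfolding tendsto_iff_p by (intro tendsto_add) auto
    then show "(\<lambda>i. p n (u i - l) + p n (v i - m)) \<longlonglongrightarrow> 0" by simp
  qed simp
qed

lemma tendsto_scale_p:
  fixes u :: "nat \<Rightarrow> 'a"
  assumes "u \<longlonglongrightarrow> l"
  shows "(\<lambda>i. scl c (u i)) \<longlonglongrightarrow> scl c l"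
  unfolding tendsto_iff_p
proof
  fix n
  have "(\<lambda>i. norm c * p n (u i - l)) \<longlonglongrightarrow> norm c * 0"
    using assms unfolding tendsto_iff_p by (intro tendsto_mult) auto
  then show "(\<lambda>i. p n (scl c (u i) - scl c l)) \<longlonglongrightarrow> 0"
    by (simp add: seminorm_scale[OF p] flip: scale_right_diff_distrib)
qed

lemma in_closure_iff: "x \<in> closure S \<longleftrightarrow> (\<forall>n. \<forall>e>0. \<exists>s\<in>S. p n (s - x) < e)"
proof
  assume x: "x \<in> closure S"
  show "\<forall>n. \<forall>e>0. \<exists>s\<in>S. p n (s - x) < e"
  proof (intro allI impI)
    fix n and e :: real assume "e > 0"
    then have "x \<in> {y. p n (y - x) < e}"
      by (simp add: seminorm_zero[OF p])
    with x open_ball[of n x e] have "{y. p n (y - x) < e} \<inter> S \<noteq> {}"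
      by (metis IntI empty_iff open_Int_closure_eq_empty)
    then show "\<exists>s\<in>S. p n (s - x) < e" by auto
  qed
next
  assume x: "\<forall>n. \<forall>e>0. \<exists>s\<in>S. p n (s - x) < e"
  show "x \<in> closure S"
  proof (rule ccontr)
    assume "x \<notin> closure S"
    then obtain n e where "e > 0" "{y. p n (y - x) < e} \<subseteq> - closure S"
      using open_iff[of "- closure S"] closed_closure[of S]
      unfolding closed_def by (meson ComplI)
    then show False
      using x closure_subset[of S] by (meson ComplD mem_Collect_eq subsetD)
  qed
qed

text \<open>The \<open>i\<close>-th term is chosen close with respect to \<open>p i\<close>; as the
  seminorms increase, this controls each fixed \<open>p n\<close> from index \<open>n\<close>
  on.\<close>

lemma in_closure_sequence:
  fixes x :: 'a
  assumes "x \<in> closure S"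
  obtains u where "\<And>i. u i \<in> S" "u \<longlonglongrightarrow> x"
proof -
  have "\<exists>s\<in>S. p i (s - x) < 1 / Suc i" for i
    using assms unfolding in_closure_iff by simp
  then obtain u where u: "\<And>i. u i \<in> S" "\<And>i. p i (u i - x) < 1 / Suc i"
    by metis
  have "u \<longlonglongrightarrow> x"
    unfolding tendsto_iff_p
  proof
    fix n
    show "(\<lambda>i. p n (u i - x)) \<longlonglongrightarrow> 0"
    proof (rule real_tendsto_sandwich)
      show "\<forall>\<^sub>F i in sequentially. 0 \<le> p n (u i - x)"
        by (simp add: seminorm_nonneg[OF p])
      show "\<forall>\<^sub>F i in sequentially. p n (u i - x) \<le> 1 / Suc i"
        using eventually_ge_at_top[of n]
      proof eventually_elim
        case (elim i)
        show ?case
          using p_mono[OF elim, of "u i - x"] u(2)[of i] by linarith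
      qed
      show "(\<lambda>i. 1 / real (Suc i)) \<longlonglongrightarrow> 0"
        using LIMSEQ_inverse_real_of_nat by (simp add: inverse_eq_divide)
    qed simp
  qed
  with u(1) show ?thesis by (rule that)
qed

lemma tendsto_in_closure:
  fixes x :: 'a
  assumes "u \<longlonglongrightarrow> x" "\<And>i. u i \<in> S"
  shows "x \<in> closure S"
  unfolding in_closure_iff
proof (intro allI impI)
  fix n and e :: real assume "e > 0"
  with assms(1) have "\<forall>\<^sub>F i in sequentially. p n (u i - x) < e"
    unfolding tendsto_iff_p by (intro order_tendstoD(2)[of _ 0]) auto
  then obtain i where "p n (u i - x) < e"
    by (auto simp: eventually_sequentially)
  then show "\<exists>s\<in>S. p n (s - x) < e"
    using assms(2) by blast
qed

lemma subspace_closure: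
  fixes S :: "'a set"
  assumes "subspace S"
  shows "subspace (closure S)"
proof (rule subspaceI)
  show "0 \<in> closure S"
    using subspace_0[OF assms] closure_subset by blast
next
  fix x y assume "x \<in> closure S" "y \<in> closure S"
  then obtain u v where uv: "\<And>i. u i \<in> S" "u \<longlonglongrightarrow> x" "\<And>i. v i \<in> S" "v \<longlonglongrightarrow> y"
    by (metis in_closure_sequence)
  show "x + y \<in> closure S"
    by (rule tendsto_in_closure[OF tendsto_add_p[OF uv(2,4)]])
       (intro subspace_add[OF assms] uv)
next
  fix c x assume "x \<in> closure S"
  then obtain u where u: "\<And>i. u i \<in> S" "u \<longlonglongrightarrow> x"
    by (metis in_closure_sequence)
  show "scl c x \<in> closure S"
    by (rule tendsto_in_closure[OF tendsto_scale_p[OF u(2)]])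
       (intro subspace_scale[OF assms] u)
qed

text \<open>A vector violating the bound, rescaled to have \<open>s\<close>-value 1, would lie in a
  \<open>p n\<close>-ball on which \<open>s < 1\<close>.\<close>

lemma seminorm_bounded:
  assumes s: "seminorm scl s" and cont: "continuous_on UNIV s"
  obtains n C where "C > 0" "\<And>x. s x \<le> C * p n x"
proof -
  have "open (s -` {..<1})"
    using cont by (intro open_vimage) auto
  moreover have "0 \<in> s -` {..<1}"
    by (simp add: seminorm_zero[OF s])
  ultimately obtain n e where e: "e > 0" and "{y. p n (y - 0) < e} \<subseteq> s -` {..<1}"
    unfolding open_iff by blast
  then have sub: "s y < 1" if "p n y < e" for y
    using that by auto
  have "s x \<le> 2 / e * p n x" for x
  proof (rule ccontr)
    assume "\<not> s x \<le> 2 / e * p n x"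
    then have less: "2 / e * p n x < s x" by simp
    have "0 \<le> 2 / e * p n x"
      using e by (simp add: seminorm_nonneg[OF p])
    with less have pos: "s x > 0" by linarith
    let ?y = "scl (of_real (1 / s x)) x"
    have "s ?y = 1"
      using pos by (simp add: seminorm_scale[OF s] norm_divide)
    moreover have "p n ?y < e"
      using pos e less seminorm_nonneg[OF p, of n x]
      by (simp add: seminorm_scale[OF p] norm_divide field_simps)
    ultimately show False
      using sub[of ?y] by simp
  qed
  with e show ?thesis
    by (intro that[of "2 / e" n]) auto
qed

lemma seminorm_tendsto:
  assumes s: "seminorm scl s" and cont: "continuous_on UNIV s" and "u \<longlonglongrightarrow> l"
  shows "(\<lambda>i. s (u i - l)) \<longlonglongrightarrow> 0"
proof -
  obtain n C where C: "\<And>x. s x \<le> C * p n x"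
    using seminorm_bounded[OF s cont] by metis
  show ?thesis
  proof (rule real_tendsto_sandwich[OF always_eventually always_eventually])
    show "\<forall>i. 0 \<le> s (u i - l)" by (simp add: seminorm_nonneg[OF s])
    show "\<forall>i. s (u i - l) \<le> C * p n (u i - l)" by (simp add: C)
    have "(\<lambda>i. C * p n (u i - l)) \<longlonglongrightarrow> C * 0"
      using assms(3) unfolding tendsto_iff_p by (intro tendsto_mult) auto
    then show "(\<lambda>i. C * p n (u i - l)) \<longlonglongrightarrow> 0" by simp
  qed simp
qed


lemma continuous_p: "continuous_on UNIV (\<lambda>y. p n (y - x))"
proof (subst continuous_on_open_vimage[OF open_UNIV], intro allI impI)
  fix B :: "real set" assume B: "open B"
  have "\<exists>m. \<exists>e>0. {z. p m (z - y) < e} \<subseteq> (\<lambda>y. p n (y - x)) -` B \<inter> UNIV"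
    if y: "p n (y - x) \<in> B" for y
  proof -
    from B y obtain e where e: "e > 0" "\<And>t. \<bar>t - p n (y - x)\<bar> < e \<Longrightarrow> t \<in> B"
      unfolding open_dist dist_real_def by blast
    have "\<bar>p n (z - x) - p n (y - x)\<bar> \<le> p n (z - y)" for z
      using seminorm_triangle[OF p, of n z x y] seminorm_triangle[OF p, of n y x z]
        seminorm_commute[OF p, of n y z] by linarith
    then have "{z. p n (z - y) < e} \<subseteq> (\<lambda>y. p n (y - x)) -` B \<inter> UNIV"
      using e(2) by (auto intro: le_less_trans)
    with e(1) show ?thesis by blast
  qed
  then show "open ((\<lambda>y. p n (y - x)) -` B \<inter> UNIV)"
    unfolding open_iff by blast
qed

lemma continuous_p_0: "continuous_on UNIV (p n)"
  using continuous_p[of n 0] by simp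

end

lemma frechet_spaceE:
  assumes "frechet_space scl"
  obtains p where "seminormed_frechet scl p"
proof -
  from assms obtain p where vs: "vector_space scl" and p: "\<forall>n. seminorm scl (p n)"
    "\<forall>n x. p n x \<le> p (Suc n) x" "\<forall>x. (\<forall>n. p n x = 0) \<longrightarrow> x = 0"
    "\<forall>U. open U \<longleftrightarrow> (\<forall>x\<in>U. \<exists>n. \<exists>e>0. {y. p n (y - x) < e} \<subseteq> U)"
    "\<forall>u :: nat \<Rightarrow> _. (\<forall>n. \<forall>e>0. \<exists>N. \<forall>i\<ge>N. \<forall>j\<ge>N. p n (u i - u j) < e) \<longrightarrow> (\<exists>l. u \<longlonglongrightarrow> l)"
    unfolding frechet_space_def by (elim conjE exE)
  interpret vector_space scl by fact
  have "seminormed_frechet scl p"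
  proof unfold_locales
    show "open U \<longleftrightarrow> (\<forall>x\<in>U. \<exists>n. \<exists>e>0. {y. p n (y - x) < e} \<subseteq> U)" for U
      by (rule p(4)[THEN spec])
    show "\<exists>l. u \<longlonglongrightarrow> l"
      if "\<And>n e. e > 0 \<Longrightarrow> \<exists>N. \<forall>i\<ge>N. \<forall>j\<ge>N. p n (u i - u j) < e" for u
      by (rule p(5)[THEN spec, THEN mp]) (intro allI impI that)
    show "x = 0" if "\<And>n. p n x = 0" for x
      by (rule p(3)[THEN spec, THEN mp]) (intro allI that)
  qed (rule p(1)[THEN spec] p(2)[THEN spec, THEN spec])+
  then show ?thesis by (rule that)
qed

section \<open>Separating functionals on a subspace\<close>

context normed_scalar_space
begin

text \<open>A maximal independent subset of \<open>S\<close> spans \<open>S\<close>, hence is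
  infinite and contains an injective sequence.\<close>

lemma infinite_dimensional_independent_sequence:
  assumes "infinite_dimensional scl S"
  obtains u :: "nat \<Rightarrow> 'a" where "inj u" "range u \<subseteq> S" "independent (range u)"
proof -
  obtain B where B: "B \<subseteq> S" "independent B" "S \<subseteq> span B"
    by (rule maximal_independent_subset)
  with assms have "infinite B"
    by (auto simp: infinite_dimensional_def)
  then obtain u :: "nat \<Rightarrow> 'a" where u: "inj u" "range u \<subseteq> B"
    using infinite_countable_subset by blast
  moreover have "independent (range u)"
    using B(2) u(2) by (rule independent_mono)
  ultimately show ?thesis
    using B(1) that by blast
qed

lemma infinite_dimensional_if_independent:
  assumes "infinite B" "independent B" "B \<subseteq> S"
  shows "infinite_dimensional scl S"
  unfolding infinite_dimensional_def using assms independent_span_bound by (meson subset_trans)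

end

context seminormed_frechet
begin

text \<open>\<open>D\<close> consists of the combinations with coefficients in the countable set
  \<open>Q\<close>. Coding them by lists gives countability, and prefixing a list entry adds a term,
  which fits induction over the span.\<close>

lemma separable_span:
  fixes u :: "nat \<Rightarrow> 'a" and Q :: "'k set"
  assumes "countable Q" and Q: "\<And>c e. e > 0 \<Longrightarrow> \<exists>c'\<in>Q. norm (c' - c) < e"
  obtains D where "countable D" "D \<noteq> {}" "span (range u) \<subseteq> closure D"
proof -
  define D where "D = (\<lambda>l. sum_list (map (\<lambda>(c, m). scl c (u m)) l)) ` lists (Q \<times> (UNIV :: nat set))"
  have "countable D"
    unfolding D_def using assms(1) by (intro countable_image countable_lists countable_SIGMA) auto
  have "0 \<in> D"
    unfolding D_def by (intro image_eqI[of _ _ "[]"]) auto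
  have D_step: "scl c (u m) + d \<in> D" if "c \<in> Q" "d \<in> D" for c m d
  proof -
    from that obtain l where "l \<in> lists (Q \<times> UNIV)"
      and "d = sum_list (map (\<lambda>(c, m). scl c (u m)) l)"
      unfolding D_def by blast
    with that show ?thesis
      unfolding D_def by (intro image_eqI[of _ _ "(c, m) # l"]) auto
  qed
  have "x \<in> closure D" if "x \<in> span (range u)" for x
    using that
  proof (induction rule: span_induct_alt)
    case base
    with \<open>0 \<in> D\<close> show ?case
      using closure_subset by blast
  next
    case (step c x y)
    then obtain m where m: "x = u m" by blast
    show ?case
      unfolding in_closure_iff
    proof (intro allI impI)
      fix n and e :: real assume e: "e > 0"
      obtain d where d: "d \<in> D" "p n (d - y) < e / 2"
        using step(2) e unfolding in_closure_iff by (meson half_gt_zero)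
      \<comment> \<open>Adding 1 avoids division by zero when \<open>p n x = 0\<close>.\<close>
      have pos: "p n x + 1 > 0"
        using seminorm_nonneg[OF p, of n x] by simp
      with e have "e / (2 * (p n x + 1)) > 0" by simp
      from Q[OF this, of c] obtain c' where c': "c' \<in> Q" "norm (c' - c) < e / (2 * (p n x + 1))"
        by blast
      have "norm (c' - c) * p n x \<le> norm (c' - c) * (p n x + 1)"
        by (intro mult_left_mono) auto
      also have "\<dots> < e / 2"
        using c'(2) pos by (simp add: field_simps)
      finally have "norm (c' - c) * p n x < e / 2" .
      moreover have eq: "scl c' x + d - (scl c x + y) = scl (c' - c) x + (d - y)"
        by (simp add: scale_left_diff_distrib)
      have "p n (scl c' x + d - (scl c x + y)) \<le> norm (c' - c) * p n x + p n (d - y)"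
        unfolding eq using seminorm_add[OF p, of n "scl (c' - c) x" "d - y"]
        by (simp add: seminorm_scale[OF p])
      ultimately have "p n (scl c' x + d - (scl c x + y)) < e"
        using d(2) by linarith
      then show "\<exists>s\<in>D. p n (s - (scl c x + y)) < e"
        using D_step[OF c'(1) d(1)] m by blast
    qed
  qed
  with \<open>countable D\<close> \<open>0 \<in> D\<close> show ?thesis
    using that by blast
qed

end

text \<open>Functionals that norm the points of a countable dense subset of \<open>U\<close> separate \<open>U\<close>.\<close>

lemma total_functionals:
  fixes scl :: "'k::{real_normed_field,euclidean_space} \<Rightarrow> 'a::{ab_group_add,topological_space} \<Rightarrow> 'a"
  assumes "seminormed_frechet scl p"
    and r: "seminorm scl r" "continuous_on UNIV r" "\<And>x. r x = 0 \<Longrightarrow> x = 0"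
    and M: "module.subspace scl M" "closed M" "infinite_dimensional scl M"
  obtains U :: "'a set" and a :: "nat \<Rightarrow> 'a \<Rightarrow> 'k"
  where "module.subspace scl U" "closed U" "U \<subseteq> M" "infinite_dimensional scl U"
    "\<And>m x y. a m (x + y) = a m x + a m y" "\<And>m c x. a m (scl c x) = c * a m x"
    "\<And>m x. norm (a m x) \<le> r x" "\<And>x. x \<in> U \<Longrightarrow> (\<And>m. a m x = 0) \<Longrightarrow> x = 0"
proof -
  interpret seminormed_frechet scl p by fact
  obtain u :: "nat \<Rightarrow> 'a" where u: "inj u" "range u \<subseteq> M" "independent (range u)"
    using infinite_dimensional_independent_sequence[OF M(3)] by blast
  define U where "U = closure (span (range u))"
  have "span (range u) \<subseteq> M"
    using u(2) M(1) by (rule span_minimal)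
  then have "U \<subseteq> M"
    unfolding U_def using M(2) by (rule closure_minimal)
  have "range u \<subseteq> U"
    unfolding U_def using span_superset closure_subset by blast
  then have "infinite_dimensional scl U"
    using u by (intro infinite_dimensional_if_independent[of "range u"]) (auto dest: range_inj_infinite)
  obtain Q :: "'k set" where Q: "countable Q" "\<And>X. open X \<Longrightarrow> X \<noteq> {} \<Longrightarrow> \<exists>c\<in>Q. c \<in> X"
    using countable_dense_exists by metis
  have "\<exists>c'\<in>Q. norm (c' - c) < e" if "e > 0" for c e
    using Q(2)[of "ball c e"] that by (auto simp: dist_norm norm_minus_commute)
  then obtain D where D: "countable D" "D \<noteq> {}" "span (range u) \<subseteq> closure D"
    using separable_span[OF Q(1)] by metis
  have "\<exists>a. (\<forall>x y. a (x + y) = a x + a y) \<and> (\<forall>c x. a (scl c x) = c * a x) \<and>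
      (\<forall>x. norm (a x) \<le> r x) \<and> r d \<le> norm (a d)" for d
    using Hahn_Banach_point[OF vector_space_axioms r(1), of d] by metis
  then obtain A where A: "\<And>d x y. A d (x + y) = A d x + A d y" "\<And>d c x. A d (scl c x) = c * A d x"
    "\<And>d x. norm (A d x) \<le> r x" "\<And>d. r d \<le> norm (A d d)"
    by metis
  define a where "a = (\<lambda>m. A (from_nat_into D m))"
  have A_diff: "A d (x - y) = A d x - A d y" for d x y
    using A(1)[of d "x - y" y] by simp
  have total: "x = 0" if "x \<in> U" and zero: "\<And>m. a m x = 0" for x
  proof -
    have "x \<in> closure D"
      using \<open>x \<in> U\<close> closure_minimal[OF D(3)] by (auto simp: U_def)
    then obtain v where v: "\<And>i. v i \<in> D" "v \<longlonglongrightarrow> x"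
      by (metis in_closure_sequence)
    \<comment> \<open>The functional norming \<open>v i\<close> vanishes at \<open>x\<close>, so
      \<open>r (v i)\<close> is at most its modulus at \<open>v i - x\<close>.\<close>
    have le: "r x \<le> 2 * r (v i - x)" for i
    proof -
      obtain m where "from_nat_into D m = v i"
        using from_nat_into_surj[OF D(1) v(1)] by blast
      with zero[of m] have "A (v i) x = 0" by (simp add: a_def)
      then have "r (v i) \<le> r (v i - x)"
        using A(4)[of "v i"] A(3)[of "v i" "v i - x"] by (simp add: A_diff)
      then show ?thesis
        using seminorm_triangle[OF r(1), of x 0 "v i"] seminorm_commute[OF r(1), of x "v i"] by simp
    qed
    have "(\<lambda>i. 2 * r (v i - x)) \<longlonglongrightarrow> 2 * 0"
      by (intro tendsto_mult seminorm_tendsto r v tendsto_const)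
    then have "r x \<le> 2 * 0"
      by (rule LIMSEQ_le_const) (use le in blast)
    then show "x = 0"
      using seminorm_nonneg[OF r(1), of x] r(3) by simp
  qed
  show ?thesis
  proof (rule that[of U a])
    show "subspace U" unfolding U_def by (intro subspace_closure subspace_span)
    show "closed U" by (simp add: U_def)
  qed (use \<open>U \<subseteq> M\<close> \<open>infinite_dimensional scl U\<close> A total in \<open>auto simp: a_def\<close>)
qed

section \<open>Perturbing the identity\<close>

text \<open>The bounds on \<open>p i (w i)\<close> give convergence of the series in every fixed
  \<open>p j\<close>, where the terms from index \<open>j\<close> on are controlled; the bounds on
  \<open>r (w i)\<close> make the sum of the series small relative to the identity.\<close>

locale small_perturbation = seminormed_frechet scl p
  for scl :: "'k::real_normed_field \<Rightarrow> 'a::{ab_group_add,topological_space} \<Rightarrow> 'a"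
    and p :: "nat \<Rightarrow> 'a \<Rightarrow> real" +
  fixes r :: "'a \<Rightarrow> real" and b :: "nat \<Rightarrow> 'a \<Rightarrow> 'k" and w :: "nat \<Rightarrow> 'a"
  assumes r: "seminorm scl r" "continuous_on UNIV r"
    and r_norm: "r x = 0 \<Longrightarrow> x = 0"
    and b_add: "b i (x + y) = b i x + b i y"
    and b_scale: "b i (scl c x) = c * b i x"
    and b_le: "norm (b i x) \<le> r x"
    and p_w: "p i (w i) \<le> (1/2) ^ (i + 2)"
    and r_w: "r (w i) \<le> (1/2) ^ (i + 2)"
begin

section \<open>The perturbing series and its sum \<open>K\<close>\<close>

definition partial :: "nat \<Rightarrow> 'a \<Rightarrow> 'a" where
  "partial N x = (\<Sum>i<N. scl (b i x) (w i))"

definition K :: "'a \<Rightarrow> 'a" where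
  "K x = (SOME l. (\<lambda>N. partial N x) \<longlonglongrightarrow> l)"

lemma seminorm_partial_sum:
  assumes "seminorm scl s"
  shows "s (\<Sum>i\<in>I. scl (b i x) (w i)) \<le> r x * (\<Sum>i\<in>I. s (w i))"
proof -
  have "s (\<Sum>i\<in>I. scl (b i x) (w i)) \<le> (\<Sum>i\<in>I. s (scl (b i x) (w i)))"
    by (rule seminorm_sum[OF assms])
  also have "\<dots> \<le> (\<Sum>i\<in>I. r x * s (w i))"
    by (intro sum_mono) (simp add: seminorm_scale[OF assms] mult_right_mono b_le seminorm_nonneg[OF assms])
  finally show ?thesis by (simp add: sum_distrib_left)
qed

lemma p_w_tail:
  assumes "j \<le> N" "N \<le> M"
  shows "(\<Sum>i\<in>{N..<M}. p j (w i)) \<le> (1/2) ^ (N + 1)"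
proof -
  have "(\<Sum>i\<in>{N..<M}. p j (w i)) \<le> (\<Sum>i\<in>{N..<M}. (1/2) ^ (i + 2))"
  proof (intro sum_mono)
    fix i assume "i \<in> {N..<M}"
    with assms have "j \<le> i" by simp
    from p_mono[OF this, of "w i"] p_w[of i] show "p j (w i) \<le> (1/2) ^ (i + 2)"
      by linarith
  qed
  also have "\<dots> \<le> (1/2) ^ (N + 1)"
    by (rule sum_half_powers[OF assms(2)])
  finally show ?thesis .
qed

lemma partial_tail:
  assumes "j \<le> N" "N \<le> M"
  shows "p j (partial M x - partial N x) \<le> r x * (1/2) ^ (N + 1)"
proof -
  have "partial M x = partial N x + (\<Sum>i\<in>{N..<M}. scl (b i x) (w i))"
    using sum.atLeastLessThan_concat[of 0 N M "\<lambda>i. scl (b i x) (w i)"] assms(2)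
    by (simp add: partial_def atLeast0LessThan)
  then have "p j (partial M x - partial N x) \<le> r x * (\<Sum>i\<in>{N..<M}. p j (w i))"
    using seminorm_partial_sum[OF p, of j x "{N..<M}"] by simp
  also have "\<dots> \<le> r x * (1/2) ^ (N + 1)"
    by (intro mult_left_mono p_w_tail assms seminorm_nonneg r)
  finally show ?thesis .
qed

lemma partial_tendsto: "(\<lambda>N. partial N x) \<longlonglongrightarrow> K x"
proof -
  have "\<exists>l. (\<lambda>N. partial N x) \<longlonglongrightarrow> l"
  proof (rule p_complete)
    fix j and e :: real assume "e > 0"
    have "(\<lambda>N. r x * ((1/2) ^ N * (1/2))) \<longlonglongrightarrow> r x * (0 * (1/2))"
      by (intro tendsto_intros) auto
    then have "\<forall>\<^sub>F N in sequentially. r x * ((1/2) ^ N * (1/2)) < e"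
      using \<open>e > 0\<close> by (intro order_tendstoD(2)) auto
    then obtain N0 where N0: "\<And>N. N \<ge> N0 \<Longrightarrow> r x * (1/2) ^ (N + 1) < e"
      by (auto simp: eventually_sequentially)
    have le: "p j (partial M x - partial N x) < e" if "N \<le> M" "max j N0 \<le> N" for M N
      using partial_tail[of j N M x] N0[of N] that by simp
    have "p j (partial M x - partial N x) < e" if "max j N0 \<le> M" "max j N0 \<le> N" for M N
      using le[of N M] le[of M N] seminorm_commute[OF p, of j "partial M x"] that
      by (cases "N \<le> M") auto
    then show "\<exists>N0. \<forall>M\<ge>N0. \<forall>N\<ge>N0. p j (partial M x - partial N x) < e"
      by blast
  qed
  then show ?thesis
    unfolding K_def by (rule someI_ex)
qed

lemma K_add: "K (x + y) = K x + K y"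
proof (rule tendsto_unique_p[OF partial_tendsto])
  have "partial N (x + y) = partial N x + partial N y" for N
    by (simp add: partial_def b_add scale_left_distrib sum.distrib)
  then show "(\<lambda>N. partial N (x + y)) \<longlonglongrightarrow> K x + K y"
    using tendsto_add_p[OF partial_tendsto partial_tendsto] by simp
qed

lemma K_scale: "K (scl c x) = scl c (K x)"
proof (rule tendsto_unique_p[OF partial_tendsto])
  have "partial N (scl c x) = scl c (partial N x)" for N
    by (simp add: partial_def b_scale scale_sum_right)
  then show "(\<lambda>N. partial N (scl c x)) \<longlonglongrightarrow> scl c (K x)"
    using tendsto_scale_p[OF partial_tendsto] by simp
qed

lemma K_diff: "K (x - y) = K x - K y"
  using K_add[of "x - y" y] by simp

text \<open>The estimate holds for every partial sum and passes to the limit by continuity of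
  \<open>s\<close>.\<close>

lemma seminorm_K_le:
  assumes s: "seminorm scl s" "continuous_on UNIV s" and B: "\<And>N. (\<Sum>i<N. s (w i)) \<le> B"
  shows "s (K x) \<le> B * r x"
proof -
  have "(\<lambda>N. s (partial N x - K x) + B * r x) \<longlonglongrightarrow> 0 + B * r x"
    by (intro tendsto_add tendsto_const seminorm_tendsto s partial_tendsto)
  moreover have "s (K x) \<le> s (partial N x - K x) + B * r x" for N
  proof -
    have "s (partial N x) \<le> r x * (\<Sum>i<N. s (w i))"
      unfolding partial_def by (rule seminorm_partial_sum[OF s(1)])
    also have "\<dots> \<le> r x * B"
      by (intro mult_left_mono B seminorm_nonneg r)
    finally have "s (partial N x) \<le> B * r x"
      by (simp add: mult.commute)
    then show ?thesis
      using seminorm_triangle[OF s(1), of "K x" 0 "partial N x"]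
        seminorm_commute[OF s(1), of "K x" "partial N x"] by simp
  qed
  ultimately show ?thesis
    using LIMSEQ_le_const[of _ "0 + B * r x"] by auto
qed

lemma r_K_le: "r (K x) \<le> r x / 2"
proof -
  have "(\<Sum>i<N. r (w i)) \<le> 1/2" for N
  proof -
    have "(\<Sum>i<N. r (w i)) \<le> (\<Sum>i\<in>{0..<N}. (1/2) ^ (i + 2))"
      unfolding atLeast0LessThan by (intro sum_mono r_w)
    also have "\<dots> \<le> (1/2) ^ (0 + 1)"
      by (rule sum_half_powers) simp
    finally show ?thesis by simp
  qed
  from seminorm_K_le[OF r this] show ?thesis by simp
qed

text \<open>The first \<open>j\<close> terms are not small for \<open>p j\<close>, but they are
  finitely many and contribute a constant depending on \<open>j\<close>; the rest is a geometric
  tail.\<close>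

lemma p_K_le: "\<exists>B. \<forall>x. p j (K x) \<le> B * r x"
proof -
  have "(\<Sum>i<N. p j (w i)) \<le> (\<Sum>i<j. p j (w i)) + (1/2) ^ (j + 1)" for N
  proof -
    \<comment> \<open>Passing to \<open>max j N\<close> also covers the case
      \<open>N < j\<close>.\<close>
    have "(\<Sum>i<N. p j (w i)) \<le> (\<Sum>i<max j N. p j (w i))"
      by (intro sum_mono2) (auto simp: seminorm_nonneg[OF p])
    also have "\<dots> = (\<Sum>i<j. p j (w i)) + (\<Sum>i\<in>{j..<max j N}. p j (w i))"
      using sum.atLeastLessThan_concat[of 0 j "max j N" "\<lambda>i. p j (w i)"]
      by (simp add: atLeast0LessThan)
    also have "\<dots> \<le> (\<Sum>i<j. p j (w i)) + (1/2) ^ (j + 1)"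
      by (intro add_left_mono p_w_tail) auto
    finally show ?thesis .
  qed
  then show ?thesis
    using seminorm_K_le[OF p continuous_p_0] by blast
qed

section \<open>The perturbed identity \<open>R\<close>: injectivity and closed range\<close>

definition R :: "'a \<Rightarrow> 'a" where
  "R x = x + K x"

lemma R_add: "R (x + y) = R x + R y"
  and R_scale: "R (scl c x) = scl c (R x)"
  and R_diff: "R (x - y) = R x - R y"
  by (simp_all add: R_def K_add K_scale K_diff scale_right_distrib)

text \<open>From \<open>x = R x - K x\<close> and \<open>r (K x) \<le> r x / 2\<close>, half of
  \<open>r x\<close> can be absorbed on the left.\<close>

lemma r_le_R: "r x \<le> 2 * r (R x)"
  using seminorm_diff[OF r(1), of "R x" "K x"] r_K_le[of x] by (simp add: R_def)

lemma R_eq_0_iff: "R x = 0 \<longleftrightarrow> x = 0"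
proof
  assume "R x = 0"
  then have "r x = 0"
    using r_le_R[of x] seminorm_nonneg[OF r(1), of x] by (simp add: seminorm_zero[OF r(1)])
  then show "x = 0" by (rule r_norm)
next
  assume "x = 0"
  then show "R x = 0"
    using R_diff[of x x] by simp
qed

lemma inj_R: "inj R"
  by (rule injI) (metis R_diff R_eq_0_iff eq_iff_diff_eq_0)

lemma R_tendsto:
  assumes "u \<longlonglongrightarrow> l"
  shows "(\<lambda>i. R (u i)) \<longlonglongrightarrow> R l"
proof -
  have "(\<lambda>i. K (u i)) \<longlonglongrightarrow> K l"
    unfolding tendsto_iff_p
  proof
    fix j
    obtain B where B: "\<And>x. p j (K x) \<le> B * r x"
      using p_K_le by blast
    show "(\<lambda>i. p j (K (u i) - K l)) \<longlonglongrightarrow> 0"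
    proof (rule real_tendsto_sandwich[OF always_eventually always_eventually])
      show "\<forall>i. 0 \<le> p j (K (u i) - K l)" by (simp add: seminorm_nonneg[OF p])
      show "\<forall>i. p j (K (u i) - K l) \<le> B * r (u i - l)"
        using B by (simp flip: K_diff)
      have "(\<lambda>i. B * r (u i - l)) \<longlonglongrightarrow> B * 0"
        by (intro tendsto_mult tendsto_const seminorm_tendsto r assms)
      then show "(\<lambda>i. B * r (u i - l)) \<longlonglongrightarrow> 0" by simp
    qed simp
  qed
  then show ?thesis
    unfolding R_def by (intro tendsto_add_p assms)
qed

text \<open>If \<open>R (u i)\<close> converges, \<open>r_le_R\<close> makes \<open>u\<close> Cauchy
  for \<open>r\<close>. Each \<open>p j (K x)\<close> is dominated by a multiple of
  \<open>r x\<close>, so \<open>u i = R (u i) - K (u i)\<close> is Cauchy for every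
  \<open>p j\<close>, and completeness applies.\<close>

lemma closed_R_image:
  assumes "closed U"
  shows "closed (R ` U)"
proof -
  have "x \<in> R ` U" if x: "x \<in> closure (R ` U)" for x
  proof -
    obtain v where v: "\<And>i. v i \<in> R ` U" "v \<longlonglongrightarrow> x"
      using in_closure_sequence[OF x] by metis
    then have "\<forall>i. \<exists>z. z \<in> U \<and> v i = R z"
      by blast
    from choice[OF this] obtain u where u: "\<And>i. u i \<in> U" "\<And>i. v i = R (u i)"
      by blast
    have "\<exists>l. u \<longlonglongrightarrow> l"
    proof (rule p_complete)
      fix j and e :: real assume e: "e > 0"
      obtain B where B: "\<And>x. p j (K x) \<le> B * r x"
        using p_K_le by blast
      \<comment> \<open>Half of the bound for \<open>p j (u i - u k)\<close>: the contribution of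
        \<open>i\<close> alone. The factor 2 comes from \<open>r_le_R\<close>, and the absolute
        value is there because the sign of \<open>B\<close> is unknown.\<close>
      define g where "g = (\<lambda>i. p j (v i - x) + \<bar>B\<bar> * 2 * r (v i - x))"
      have "g \<longlonglongrightarrow> 0 + \<bar>B\<bar> * 2 * 0"
        unfolding g_def
        by (intro tendsto_add tendsto_mult tendsto_const seminorm_tendsto r p continuous_p_0 v(2))
      then have "\<forall>\<^sub>F i in sequentially. g i < e / 2"
        using e by (intro order_tendstoD(2)) auto
      then obtain N where N: "\<And>i. i \<ge> N \<Longrightarrow> g i < e / 2"
        by (auto simp: eventually_sequentially)
      have "p j (u i - u k) \<le> g i + g k" for i k
      proof -
        have v_diff: "v i - v k = R (u i - u k)" by (simp add: u R_diff)
        have "p j (u i - u k) \<le> p j (v i - v k) + p j (K (u i - u k))"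
          using seminorm_diff[OF p, of j "v i - v k" "K (u i - u k)"] by (simp add: v_diff R_def)
        also have "p j (K (u i - u k)) \<le> \<bar>B\<bar> * r (u i - u k)"
          using B[of "u i - u k"] seminorm_nonneg[OF r(1), of "u i - u k"]
          by (meson abs_ge_self mult_right_mono order_trans)
        also have "\<dots> \<le> \<bar>B\<bar> * (2 * r (v i - v k))"
          unfolding v_diff by (intro mult_left_mono r_le_R) auto
        also have "\<dots> \<le> \<bar>B\<bar> * (2 * (r (v i - x) + r (v k - x)))"
          using seminorm_triangle[OF r(1), of "v i" "v k" x] seminorm_commute[OF r(1), of x "v k"]
          by (intro mult_left_mono) auto
        also have "p j (v i - v k) \<le> p j (v i - x) + p j (v k - x)"
          using seminorm_triangle[OF p, of j "v i" "v k" x] seminorm_commute[OF p, of j x "v k"]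
          by simp
        finally show ?thesis by (simp add: g_def algebra_simps)
      qed
      with N have "p j (u i - u k) < e" if "i \<ge> N" "k \<ge> N" for i k
        using that by (smt (verit) field_sum_of_halves)
      then show "\<exists>N. \<forall>i\<ge>N. \<forall>k\<ge>N. p j (u i - u k) < e" by blast
    qed
    then obtain l where l: "u \<longlonglongrightarrow> l" by blast
    have "l \<in> U"
      using tendsto_in_closure[OF l u(1)] assms by simp
    moreover have "v \<longlonglongrightarrow> R l"
      using R_tendsto[OF l] unfolding u(2)[symmetric] .
    then have "x = R l"
      by (rule tendsto_unique_p[OF v(2)])
    ultimately show ?thesis by blast
  qed
  then have "closure (R ` U) = R ` U"
    using closure_subset[of "R ` U"] by blast
  then show ?thesis
    using closed_closure[of "R ` U"] by simp
qed

lemma subspace_R_image: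
  assumes U: "subspace U"
  shows "subspace (R ` U)"
proof (rule subspaceI)
  show "0 \<in> R ` U"
    using subspace_0[OF U] R_eq_0_iff[of 0] by force
  show "x + y \<in> R ` U" if "x \<in> R ` U" "y \<in> R ` U" for x y
    using that subspace_add[OF U] by (auto simp flip: R_add)
  show "scl c x \<in> R ` U" if "x \<in> R ` U" for c x
    using that subspace_scale[OF U] by (auto simp flip: R_scale)
qed

lemma infinite_dimensional_R_image:
  assumes "infinite_dimensional scl U"
  shows "infinite_dimensional scl (R ` U)"
proof -
  interpret pair: vector_space_pair scl scl ..
  obtain u :: "nat \<Rightarrow> 'a" where u: "inj u" "range u \<subseteq> U" "independent (range u)"
    using infinite_dimensional_independent_sequence[OF assms] by blast
  have "Vector_Spaces.linear scl scl R"
    using vector_space_axioms by (simp add: Vector_Spaces.linear_iff R_add R_scale)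
  then have "independent (R ` range u)"
    using u(3) inj_R by (intro pair.linear_independent_injective_image) (auto intro: inj_on_subset)
  moreover have "infinite (R ` range u)"
    using u(1) inj_R by (metis finite_imageD inj_on_subset range_inj_infinite subset_UNIV)
  ultimately show ?thesis
    using u(2) by (intro infinite_dimensional_if_independent[of "R ` range u"]) auto
qed

end

section \<open>Approximating along a sequence of operators\<close>

lemma denseD:
  assumes "dense A" "open U" "x \<in> U"
  shows "\<exists>y\<in>A. y \<in> U"
  using assms open_Int_closure_eq_empty[of U A] by (auto simp: dense_def)

locale frechet_operators =
  X: seminormed_frechet sX p + Y: seminormed_frechet sY q
  for sX :: "'k::real_normed_field \<Rightarrow> 'x::{ab_group_add,topological_space} \<Rightarrow> 'x"
    and p :: "nat \<Rightarrow> 'x \<Rightarrow> real"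
    and sY :: "'k \<Rightarrow> 'y::{ab_group_add,topological_space} \<Rightarrow> 'y"
    and q :: "nat \<Rightarrow> 'y \<Rightarrow> real" +
  fixes S :: "nat \<Rightarrow> 'x \<Rightarrow> 'y"
  assumes S_linear: "Vector_Spaces.linear sX sY (S k)"
    and S_cont: "continuous_on UNIV (S k)"
begin

lemma S_add: "S k (x + y) = S k x + S k y"
  and S_scale: "S k (sX c x) = sY c (S k x)"
  using S_linear[of k] by (auto simp: Vector_Spaces.linear_iff)

lemma S_zero: "S k 0 = 0"
  using S_scale[of k 0 0] by simp

lemma S_sum: "S k (\<Sum>i\<in>I. f i) = (\<Sum>i\<in>I. S k (f i))"
  by (induction I rule: infinite_finite_induct) (simp_all add: S_zero S_add)

lemma seminorm_q_S: "seminorm sX (\<lambda>x. q j (S k x))"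
  using Y.p[of j] by (auto simp: seminorm_def S_add S_scale)

lemma continuous_q_S: "continuous_on UNIV (\<lambda>x. q j (S k x - y))"
  using continuous_on_compose2[OF Y.continuous_p S_cont] by simp

lemma continuous_q_S_0: "continuous_on UNIV (\<lambda>x. q j (S k x))"
  using continuous_q_S[of j k 0] by simp

text \<open>Density alone controls no index. For \<open>y = 0\<close> the zero vector works with
  \<open>k = N\<close>. Otherwise early operators are penalized in the seminorm: if
  \<open>k < N\<close>, both \<open>q J (S k x)\<close> and \<open>q J (S k x - y)\<close> would be
  below \<open>\<delta> / 2\<close>, contradicting \<open>\<delta> = q J y\<close>.\<close>

lemma late_approximation:
  assumes images_dense: "\<And>s. seminorm sX s \<Longrightarrow> continuous_on UNIV s \<Longrightarrow>
      dense (\<Union>k. S k ` {x. s x < 1})"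
    and s: "seminorm sX s" "continuous_on UNIV s" and e: "e > 0"
  obtains k x where "k \<ge> N" "s x < 1" "q j (S k x - y) < e"
proof (cases "y = 0")
  case True
  then show ?thesis
    using e that[of N 0] by (simp add: S_zero X.seminorm_zero[OF s(1)] Y.seminorm_zero[OF Y.p])
next
  case False
  then obtain j' where "q j' y \<noteq> 0"
    using Y.p_separating by blast
  then have "0 < q j' y"
    using Y.seminorm_nonneg[OF Y.p, of j' y] by simp
  \<comment> \<open>\<open>q J\<close> must both detect \<open>y\<close>, through \<open>j'\<close>,
    and dominate \<open>q j\<close>.\<close>
  define J where "J = max j j'"
  define \<delta> where "\<delta> = q J y"
  have "\<delta> > 0"
    using \<open>0 < q j' y\<close> Y.p_mono[of j' J y] by (simp add: \<delta>_def J_def)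
  text \<open>The penalty keeps the images under \<open>S k\<close> with \<open>k < N\<close> away from \<open>y\<close>.\<close>
  define s' where "s' = (\<lambda>x. s x + (\<Sum>k<N. 2 / \<delta> * q J (S k x)))"
  have nonneg: "0 \<le> 2 / \<delta> * q J (S k x)" for k x
    using \<open>\<delta> > 0\<close> by (simp add: Y.seminorm_nonneg[OF Y.p])
  have "seminorm sX s'"
    unfolding s'_def using \<open>\<delta> > 0\<close>
    by (intro X.seminorm_plus X.seminorm_sum_seminorms X.seminorm_times seminorm_q_S s) auto
  moreover have "continuous_on UNIV s'"
    unfolding s'_def by (intro continuous_intros s continuous_q_S_0)
  ultimately have dense_s': "dense (\<Union>k. S k ` {x. s' x < 1})"
    by (rule images_dense)
  have "y \<in> {z. q J (z - y) < min e (\<delta> / 2)}"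
    using e \<open>\<delta> > 0\<close> by (simp add: Y.seminorm_zero[OF Y.p])
  from denseD[OF dense_s' Y.open_ball this]
  obtain k x where x: "s' x < 1" and close: "q J (S k x - y) < min e (\<delta> / 2)"
    by auto
  have "k \<ge> N"
  proof (rule ccontr)
    assume "\<not> k \<ge> N"
    then have "2 / \<delta> * q J (S k x) \<le> (\<Sum>k<N. 2 / \<delta> * q J (S k x))"
      using nonneg by (intro member_le_sum) auto
    also have "\<dots> < 1"
      using x X.seminorm_nonneg[OF s(1), of x] by (simp add: s'_def)
    finally have "q J (S k x) < \<delta> / 2"
      using \<open>\<delta> > 0\<close> by (simp add: field_simps)
    moreover have "\<delta> \<le> q J (S k x) + q J (S k x - y)"
      using Y.seminorm_diff[OF Y.p, of J "S k x" "S k x - y"] by (simp add: \<delta>_def)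
    ultimately show False
      using close by simp
  qed
  moreover have "s x < 1"
    using x sum_nonneg[of "{..<N}" "\<lambda>k. 2 / \<delta> * q J (S k x)"] nonneg by (simp add: s'_def)
  moreover have "q j (S k x - y) < e"
    using close Y.p_mono[of j J "S k x - y"] by (simp add: J_def)
  ultimately show ?thesis by (rule that)
qed

text \<open>For fixed \<open>k\<close> the two inequalities are open conditions on \<open>x\<close>,
  so \<open>x\<close> can be moved into \<open>X0\<close>.\<close>

lemma late_approximation_in_dense:
  assumes images_dense: "\<And>s. seminorm sX s \<Longrightarrow> continuous_on UNIV s \<Longrightarrow>
      dense (\<Union>k. S k ` {x. s x < 1})"
    and "dense X0" and s: "seminorm sX s" "continuous_on UNIV s" and e: "e > 0"
  obtains k x where "k \<ge> N" "x \<in> X0" "s x < 1" "q j (S k x - y) < e"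
proof -
  obtain k x where kx: "k \<ge> N" "s x < 1" "q j (S k x - y) < e"
    using late_approximation[OF images_dense s e] by blast
  define V where "V = (s -` {..<1}) \<inter> ((\<lambda>x. q j (S k x - y)) -` {..<e})"
  have "open V"
    unfolding V_def by (intro open_Int open_vimage s continuous_q_S) auto
  moreover have "x \<in> V"
    using kx by (simp add: V_def)
  ultimately obtain x' where "x' \<in> X0" "x' \<in> V"
    using denseD[OF \<open>dense X0\<close>] by blast
  with kx(1) show ?thesis
    by (intro that[of k x']) (auto simp: V_def)
qed

text \<open>Stage \<open>i\<close> of the construction picks the pair \<open>f i\<close> of an index \<open>\<kappa> i\<close> and a vector \<open>w i\<close>, given
  the earlier pairs.\<close>

definition blocks :: "('x \<Rightarrow> real) \<Rightarrow> (nat \<Rightarrow> 'y) \<Rightarrow> 'x set \<Rightarrow> (nat \<Rightarrow> nat \<times> 'x) \<Rightarrow> nat \<Rightarrow> nat \<times> 'x \<Rightarrow> bool"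
  where "blocks r y X0 f i kx \<longleftrightarrow>
    fst kx \<ge> i \<and> snd kx \<in> X0 \<and> p i (snd kx) \<le> (1/2) ^ (i + 2) \<and> r (snd kx) \<le> (1/2) ^ (i + 2) \<and>
    q i (S (fst kx) (snd kx) - y i) \<le> (1/2) ^ i \<and>
    (\<forall>l<i. q i (S (fst (f l)) (snd kx)) \<le> (1/2) ^ i) \<and>
    (\<forall>l<i. q i (S (fst kx) (snd (f l))) \<le> (1/2) ^ i)"

text \<open>The earlier vectors lie in \<open>X0\<close>, so all sufficiently late operators make
  them small; the earlier operators are continuous, so a sufficiently small new vector has small
  images under them.\<close>

lemma blocks_exist:
  assumes images_dense: "\<And>s. seminorm sX s \<Longrightarrow> continuous_on UNIV s \<Longrightarrow>
      dense (\<Union>k. S k ` {x. s x < 1})"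
    and X0: "dense X0" "\<And>x. x \<in> X0 \<Longrightarrow> (\<lambda>k. S k x) \<longlonglongrightarrow> 0"
    and r: "seminorm sX r" "continuous_on UNIV r"
  shows "\<exists>f. \<forall>i. blocks r y X0 f i (f i)"
proof (rule dependent_wellorder_choice)
  show "blocks r y X0 f i kx = blocks r y X0 g i kx" if "\<And>l. l < i \<Longrightarrow> f l = g l" for kx f g i
    using that by (simp add: blocks_def)
next
  fix i f assume prev: "\<And>l. l < i \<Longrightarrow> blocks r y X0 f l (f l)"
  \<comment> \<open>Only finitely many earlier vectors occur, so one threshold \<open>N\<close>
    serves them all.\<close>
  have "\<exists>N. \<forall>l<i. \<forall>k\<ge>N. q i (S k (snd (f l))) \<le> (1/2) ^ i"
  proof -
    have "\<forall>\<^sub>F k in sequentially. q i (S k (snd (f l))) < (1/2) ^ i" if "l < i" for l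
    proof -
      have "(\<lambda>k. S k (snd (f l))) \<longlonglongrightarrow> 0"
        using prev[OF that] by (intro X0) (simp add: blocks_def)
      then have "(\<lambda>k. q i (S k (snd (f l)) - 0)) \<longlonglongrightarrow> 0"
        unfolding Y.tendsto_iff_p by blast
      then show ?thesis
        by (intro order_tendstoD(2)[of _ 0]) auto
    qed
    then have "\<forall>\<^sub>F k in sequentially. \<forall>l\<in>{..<i}. q i (S k (snd (f l))) < (1/2) ^ i"
      by (intro eventually_ball_finite) auto
    then show ?thesis
      unfolding eventually_sequentially by (meson lessThan_iff less_imp_le)
  qed
  then obtain N where N: "\<And>l k. l < i \<Longrightarrow> k \<ge> N \<Longrightarrow> q i (S k (snd (f l))) \<le> (1/2) ^ i"
    by blast
  \<comment> \<open>All smallness requirements on the new vector in one continuous seminorm;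
    \<open>2 ^ (i + 2)\<close> turns \<open>s x < 1\<close> into the bound
    \<open>(1/2) ^ (i + 2)\<close> on each summand.\<close>
  define s where "s = (\<lambda>x. 2 ^ (i + 2) * (p i x + r x + (\<Sum>l<i. q i (S (fst (f l)) x))))"
  have nonneg: "0 \<le> p i x" "0 \<le> r x" "0 \<le> q i (S k x)" for k x
    by (simp_all add: X.seminorm_nonneg[OF X.p] X.seminorm_nonneg[OF r(1)] Y.seminorm_nonneg[OF Y.p])
  have "seminorm sX s"
    unfolding s_def
    by (intro X.seminorm_plus X.seminorm_sum_seminorms X.seminorm_times seminorm_q_S r X.p) auto
  moreover have "continuous_on UNIV s"
    unfolding s_def by (intro continuous_intros r continuous_q_S_0 X.continuous_p_0)
  \<comment> \<open>The maximum with \<open>i\<close> ensures that the chosen indices tend to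
    infinity.\<close>
  ultimately obtain k x where kx: "k \<ge> max N i" "x \<in> X0" "s x < 1" "q i (S k x - y i) < (1/2) ^ i"
    using late_approximation_in_dense[OF images_dense X0(1), of s "(1/2) ^ i"]
    by (metis zero_less_power half_gt_zero zero_less_one)
  have total: "p i x + r x + (\<Sum>l<i. q i (S (fst (f l)) x)) < (1/2) ^ (i + 2)"
    using kx(3) by (simp add: s_def field_simps power_one_over)
  have sum_nonneg: "0 \<le> (\<Sum>l<i. q i (S (fst (f l)) x))"
    by (intro sum_nonneg nonneg)
  have "p i x \<le> (1/2) ^ (i + 2)" "r x \<le> (1/2) ^ (i + 2)"
    using total sum_nonneg nonneg(1,2)[of x] by linarith+
  moreover have "q i (S (fst (f l)) x) \<le> (1/2) ^ i" if "l < i" for l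
  proof -
    have "q i (S (fst (f l)) x) \<le> (\<Sum>l<i. q i (S (fst (f l)) x))"
      using that by (intro member_le_sum nonneg) auto
    moreover have "(1/2::real) ^ (i + 2) \<le> (1/2) ^ i"
      by (rule power_decreasing) auto
    ultimately show ?thesis
      using total nonneg(1,2)[of x] by linarith
  qed
  ultimately have "blocks r y X0 f i (k, x)"
    using kx N by (auto simp: blocks_def)
  then show "\<exists>kx. blocks r y X0 f i kx" by blast
qed

end

locale perturbation_by_blocks =
  frechet_operators sX p sY q S + small_perturbation sX p r b w
  for sX :: "'k::real_normed_field \<Rightarrow> 'x::{ab_group_add,topological_space} \<Rightarrow> 'x"
    and p :: "nat \<Rightarrow> 'x \<Rightarrow> real"
    and sY :: "'k \<Rightarrow> 'y::{ab_group_add,topological_space} \<Rightarrow> 'y"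
    and q :: "nat \<Rightarrow> 'y \<Rightarrow> real"
    and S :: "nat \<Rightarrow> 'x \<Rightarrow> 'y"
    and r :: "'x \<Rightarrow> real" and b :: "nat \<Rightarrow> 'x \<Rightarrow> 'k" and w :: "nat \<Rightarrow> 'x" +
  fixes \<kappa> :: "nat \<Rightarrow> nat" and y :: "nat \<Rightarrow> 'y"
  assumes hit: "q i (S (\<kappa> i) (w i) - y i) \<le> (1/2) ^ i"
    and later: "l < i \<Longrightarrow> q i (S (\<kappa> l) (w i)) \<le> (1/2) ^ i"
    and earlier: "l < i \<Longrightarrow> q i (S (\<kappa> i) (w l)) \<le> (1/2) ^ i"
begin

section \<open>Images of the perturbed vectors\<close>

text \<open>Term \<open>l\<close> contributes an error of at most
  \<open>r x * (1/2) ^ max i l\<close>. The \<open>i + 1\<close> terms with \<open>l \<le> i\<close>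
  and the geometric tail, which counts as one more, give the factor \<open>i + 2\<close>.\<close>

lemma partial_image_close:
  assumes "j \<le> i" "i < N"
  shows "q j (S (\<kappa> i) (partial N x) - sY (b i x) (y i)) \<le> r x * (real (i + 2) * (1/2) ^ i)"
proof -
  define f where "f = (\<lambda>l. sY (b l x) (S (\<kappa> i) (w l) - (if l = i then y i else 0)))"
  define g where "g = (\<lambda>l. (1/2::real) ^ max i l)"
  have "(\<Sum>l<N. f l) = S (\<kappa> i) (partial N x) - (\<Sum>l<N. if l = i then sY (b i x) (y i) else 0)"
    unfolding partial_def S_sum sum_subtractf[symmetric]
    by (intro sum.cong) (auto simp: f_def S_scale Y.scale_right_diff_distrib)
  also have "\<dots> = S (\<kappa> i) (partial N x) - sY (b i x) (y i)"
    using assms(2) by simp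
  finally have sum_f: "S (\<kappa> i) (partial N x) - sY (b i x) (y i) = (\<Sum>l<N. f l)" ..
  have f_le: "q j (f l) \<le> r x * g l" for l
  proof -
    consider "l < i" | "l = i" | "i < l" by linarith
    then have "q j (S (\<kappa> i) (w l) - (if l = i then y i else 0)) \<le> g l"
    proof cases
      case 1
      then show ?thesis
        using Y.p_mono[OF assms(1), of "S (\<kappa> i) (w l)"] earlier[of l i] by (simp add: g_def)
    next
      case 2
      then show ?thesis
        using Y.p_mono[OF assms(1), of "S (\<kappa> i) (w i) - y i"] hit[of i] by (simp add: g_def)
    next
      case 3
      then show ?thesis
        using Y.p_mono[of j l "S (\<kappa> i) (w l)"] later[of i l] assms(1) by (simp add: g_def)
    qed
    then show ?thesis
      unfolding f_def Y.seminorm_scale[OF Y.p]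
      by (intro mult_mono b_le Y.seminorm_nonneg[OF Y.p] X.seminorm_nonneg[OF r(1)])
  qed
  have "q j (\<Sum>l<N. f l) \<le> (\<Sum>l<N. q j (f l))"
    by (rule Y.seminorm_sum[OF Y.p])
  also have "\<dots> \<le> (\<Sum>l<N. r x * g l)"
    by (intro sum_mono f_le)
  also have "\<dots> = r x * (\<Sum>l<N. g l)"
    by (simp add: sum_distrib_left)
  also have "(\<Sum>l<N. g l) = (\<Sum>l<i+1. g l) + (\<Sum>l\<in>{i+1..<N}. g l)"
    using sum.atLeastLessThan_concat[of 0 "i+1" N g] assms(2) by (simp add: atLeast0LessThan)
  also have "(\<Sum>l<i+1. g l) = (\<Sum>l<i+1. (1/2) ^ i)"
    by (intro sum.cong) (auto simp: g_def)
  also have "\<dots> = real (i + 1) * (1/2) ^ i"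
    by simp
  \<comment> \<open>The factor 4 matches the exponent shift in
    \<open>sum_half_powers\<close>.\<close>
  also have "(\<Sum>l\<in>{i+1..<N}. g l) = 4 * (\<Sum>l\<in>{i+1..<N}. (1/2) ^ (l + 2))"
    unfolding sum_distrib_left by (intro sum.cong) (auto simp: g_def)
  also have "(\<Sum>l\<in>{i+1..<N}. (1/2::real) ^ (l + 2)) \<le> (1/2) ^ (i + 1 + 1)"
    using assms(2) by (intro sum_half_powers) simp
  also have "real (i + 1) * (1/2) ^ i + 4 * (1/2) ^ (i + 1 + 1) = real (i + 2) * (1/2) ^ i"
    by (simp add: algebra_simps)
  finally show ?thesis
    using X.seminorm_nonneg[OF r(1), of x] by (simp add: sum_f mult_left_mono)
qed

text \<open>\<open>R x\<close> is split into \<open>x\<close>, a partial sum and a remainder;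
  \<open>S (\<kappa> i)\<close> is continuous, so the image of the remainder vanishes as
  \<open>N\<close> grows with \<open>i\<close> fixed.\<close>

lemma image_close:
  assumes "j \<le> i"
  shows "q j (S (\<kappa> i) (R x) - sY (b i x) (y i)) \<le>
    q j (S (\<kappa> i) x) + r x * (real (i + 2) * (1/2) ^ i)"
proof -
  let ?P = "\<lambda>N. q j (S (\<kappa> i) (K x - partial N x))"
  let ?B = "q j (S (\<kappa> i) x) + r x * (real (i + 2) * (1/2) ^ i)"
  have "(\<lambda>N. q j (S (\<kappa> i) (partial N x - K x))) \<longlonglongrightarrow> 0"
    by (intro X.seminorm_tendsto seminorm_q_S continuous_q_S_0 partial_tendsto)
  then have "?P \<longlonglongrightarrow> 0"
    by (simp add: X.seminorm_commute[OF seminorm_q_S])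
  then have "(\<lambda>N. ?P N + ?B) \<longlonglongrightarrow> 0 + ?B"
    by (intro tendsto_add tendsto_const)
  \<comment> \<open>\<open>N\<close> must exceed \<open>i\<close> for the partial sum to contain the
    term with \<open>w i\<close>.\<close>
  moreover have "q j (S (\<kappa> i) (R x) - sY (b i x) (y i)) \<le> ?P N + ?B" if "N \<ge> Suc i" for N
  proof -
    let ?D = "S (\<kappa> i) (partial N x) - sY (b i x) (y i)"
    have "R x = x + (K x - partial N x) + partial N x"
      by (simp add: R_def)
    then have eq: "S (\<kappa> i) (R x) - sY (b i x) (y i) =
        S (\<kappa> i) (K x - partial N x) + (S (\<kappa> i) x + ?D)"
      by (simp only: S_add) (simp add: algebra_simps)
    have "q j (S (\<kappa> i) (R x) - sY (b i x) (y i)) \<le> ?P N + (q j (S (\<kappa> i) x) + q j ?D)"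
      unfolding eq by (rule order_trans[OF Y.seminorm_add[OF Y.p]])
        (intro add_left_mono Y.seminorm_add[OF Y.p])
    also have "q j ?D \<le> r x * (real (i + 2) * (1/2) ^ i)"
      using that assms by (intro partial_image_close) auto
    finally show ?thesis by simp
  qed
  ultimately have "q j (S (\<kappa> i) (R x) - sY (b i x) (y i)) \<le> 0 + ?B"
    by (intro LIMSEQ_le_const) blast+
  then show ?thesis by simp
qed

text \<open>Along stages with constant coefficient and constant target, both errors in
  \<open>image_close\<close> vanish: \<open>S k x\<close> tends to 0 and
  \<open>(i + 2) / 2 ^ i\<close> does too.\<close>

lemma image_tendsto:
  assumes "(\<lambda>k. S k x) \<longlonglongrightarrow> 0" and "\<And>i. \<kappa> i \<ge> i"
    and \<iota>: "\<And>c. \<iota> c \<ge> c" "\<And>c. b (\<iota> c) x = \<beta>" "\<And>c. y (\<iota> c) = z"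
  shows "(\<lambda>c. S (\<kappa> (\<iota> c)) (R x)) \<longlonglongrightarrow> sY \<beta> z"
  unfolding Y.tendsto_iff_p
proof
  fix j
  have lim_\<iota>: "filterlim \<iota> at_top at_top"
    by (rule filterlim_at_top_mono[OF filterlim_ident]) (simp add: \<iota>)
  have "filterlim \<kappa> at_top at_top"
    by (rule filterlim_at_top_mono[OF filterlim_ident]) (simp add: assms(2))
  then have lim_\<kappa>: "filterlim (\<lambda>c. \<kappa> (\<iota> c)) at_top at_top"
    by (rule filterlim_compose[OF _ lim_\<iota>])
  have "(\<lambda>k. q j (S k x)) \<longlonglongrightarrow> 0"
    using assms(1) unfolding Y.tendsto_iff_p by simp
  from filterlim_compose[OF this lim_\<kappa>]
  have lim1: "(\<lambda>c. q j (S (\<kappa> (\<iota> c)) x)) \<longlonglongrightarrow> 0" .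
  have "(\<lambda>i. real i * (1/2) ^ i + 2 * (1/2) ^ i) \<longlonglongrightarrow> 0 + 2 * 0"
    by (intro tendsto_add tendsto_mult tendsto_const powser_times_n_limit_0 LIMSEQ_power_zero) auto
  then have "(\<lambda>i. real (i + 2) * (1/2) ^ i) \<longlonglongrightarrow> 0"
    by (simp add: distrib_right add.commute)
  then have lim2: "(\<lambda>c. real (\<iota> c + 2) * (1/2) ^ \<iota> c) \<longlonglongrightarrow> 0"
    by (rule filterlim_compose[OF _ lim_\<iota>])
  show "(\<lambda>c. q j (S (\<kappa> (\<iota> c)) (R x) - sY \<beta> z)) \<longlonglongrightarrow> 0"
  proof (rule real_tendsto_sandwich)
    show "\<forall>\<^sub>F c in sequentially. 0 \<le> q j (S (\<kappa> (\<iota> c)) (R x) - sY \<beta> z)"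
      by (simp add: Y.seminorm_nonneg[OF Y.p])
    show "\<forall>\<^sub>F c in sequentially. q j (S (\<kappa> (\<iota> c)) (R x) - sY \<beta> z) \<le>
        q j (S (\<kappa> (\<iota> c)) x) + r x * (real (\<iota> c + 2) * (1/2) ^ \<iota> c)"
      using eventually_ge_at_top[of j]
    proof eventually_elim
      case (elim c)
      then have "j \<le> \<iota> c" using \<iota>(1)[of c] by simp
      from image_close[OF this, of x] show ?case by (simp add: \<iota>)
    qed
    have "(\<lambda>c. q j (S (\<kappa> (\<iota> c)) x) + r x * (real (\<iota> c + 2) * (1/2) ^ \<iota> c)) \<longlonglongrightarrow> 0 + r x * 0"
      by (intro tendsto_add tendsto_mult tendsto_const lim1 lim2)
    then show "(\<lambda>c. q j (S (\<kappa> (\<iota> c)) x) + r x * (real (\<iota> c + 2) * (1/2) ^ \<iota> c)) \<longlonglongrightarrow> 0"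
      by simp
  qed simp
qed

end

section \<open>Hypercyclic subspaces\<close>

theorem theorem1p10:
  fixes scaleX :: "'k::{real_normed_field,euclidean_space} \<Rightarrow> 'x::{ab_group_add,topological_space} \<Rightarrow> 'x"
    and scaleY :: "'k \<Rightarrow> 'y::{ab_group_add,topological_space} \<Rightarrow> 'y"
    and T :: "nat \<Rightarrow> 'x \<Rightarrow> 'y"
    and n :: "nat \<Rightarrow> nat"
    and M0 :: "'x set"
  assumes "frechet_space scaleX"
    and "infinite_dimensional scaleX (UNIV :: 'x set)"
    and "has_continuous_norm scaleX"
    and "frechet_space scaleY"
    and "\<exists>D :: 'y set. countable D \<and> dense D"
    and "\<And>m. m \<ge> 1 \<Longrightarrow> Vector_Spaces.linear scaleX scaleY (T m)"
    and "\<And>m. m \<ge> 1 \<Longrightarrow> continuous_on UNIV (T m)"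
    and "strict_mono n"
    and "\<And>k. n k \<ge> 1"
    and "condition_C scaleX T n"
    and "module.subspace scaleX M0"
    and "closed M0"
    and "infinite_dimensional scaleX M0"
    and "\<And>x. x \<in> M0 \<Longrightarrow> (\<lambda>k. T (n k) x) \<longlonglongrightarrow> 0"
  shows "\<exists>M. hypercyclic_subspace scaleX T M"
proof -
  obtain p where "seminormed_frechet scaleX p"
    using frechet_spaceE[OF assms(1)] .
  then interpret X: seminormed_frechet scaleX p .
  obtain q where "seminormed_frechet scaleY q"
    using frechet_spaceE[OF assms(4)] .
  then interpret Y: seminormed_frechet scaleY q .
  define S where "S = (\<lambda>k. T (n k))"
  interpret frechet_operators scaleX p scaleY q S
  proof (intro frechet_operators.intro frechet_operators_axioms.intro)
    show "Vector_Spaces.linear scaleX scaleY (S k)" "continuous_on UNIV (S k)" for k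
      unfolding S_def by (intro assms(6,7,9))+
  qed (rule X.seminormed_frechet_axioms Y.seminormed_frechet_axioms)+
  obtain r where r: "seminorm scaleX r" "\<And>x. r x = 0 \<Longrightarrow> x = 0" "continuous_on UNIV r"
    using assms(3) unfolding has_continuous_norm_def by blast
  obtain X0 where X0: "dense X0" "\<And>x. x \<in> X0 \<Longrightarrow> (\<lambda>k. S k x) \<longlonglongrightarrow> 0"
    and images_dense: "\<And>s. seminorm scaleX s \<Longrightarrow> continuous_on UNIV s \<Longrightarrow>
      dense (\<Union>k. S k ` {x. s x < 1})"
    using assms(10) unfolding condition_C_def S_def by blast
  obtain U :: "'x set" and a :: "nat \<Rightarrow> 'x \<Rightarrow> 'k"
    where U: "X.subspace U" "closed U" "U \<subseteq> M0" "infinite_dimensional scaleX U"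
      and a: "\<And>m x y. a m (x + y) = a m x + a m y" "\<And>m c x. a m (scaleX c x) = c * a m x"
        "\<And>m x. norm (a m x) \<le> r x"
      and total: "\<And>x. x \<in> U \<Longrightarrow> (\<And>m. a m x = 0) \<Longrightarrow> x = 0"
    using total_functionals[OF X.seminormed_frechet_axioms r(1,3,2) assms(11-13)] by metis
  obtain D :: "'y set" where D: "countable D" "dense D"
    using assms(5) by blast
  then have "D \<noteq> {}"
    by (auto simp: dense_def)
  define d where "d = from_nat_into D"
  have range_d: "range d = D"
    unfolding d_def by (rule range_from_nat_into[OF \<open>D \<noteq> {}\<close> D(1)])
  text \<open>Every pair of a functional \<open>a m\<close> and a target \<open>d j\<close> occurs at infinitely many stages.\<close>
  define t where "t = (\<lambda>i. prod_decode (fst (prod_decode i)))"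
  define b where "b = (\<lambda>i. a (fst (t i)))"
  define y where "y = (\<lambda>i. d (snd (t i)))"
  obtain f where f: "\<And>i. blocks r y X0 f i (f i)"
    using blocks_exist[OF images_dense X0 r(1,3)] by blast
  define \<kappa> where "\<kappa> = (\<lambda>i. fst (f i))"
  define w where "w = (\<lambda>i. snd (f i))"
  interpret perturbation_by_blocks scaleX p scaleY q S r b w \<kappa> y
    by unfold_locales (use f in \<open>auto simp: r a b_def \<kappa>_def w_def blocks_def\<close>)
  have \<kappa>: "\<kappa> i \<ge> i" for i
    using f[of i] by (simp add: \<kappa>_def blocks_def)
  have "hypercyclic_vector T (R x)" if x: "x \<in> U" "x \<noteq> 0" for x
  proof -
    let ?O = "{T m (R x) |m. m \<ge> 1}"
    obtain m where m: "a m x \<noteq> 0"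
      using total x by blast
    have "scaleY (a m x) z \<in> closure ?O" if z: "z \<in> D" for z
    proof -
      obtain j where j: "z = d j"
        using z range_d by blast
      \<comment> \<open>Every stage of this form decodes to the pair \<open>(m, j)\<close>, while
        \<open>c\<close> makes the stages unbounded.\<close>
      define \<iota> where "\<iota> = (\<lambda>c. prod_encode (prod_encode (m, j), c))"
      have "(\<lambda>c. S (\<kappa> (\<iota> c)) (R x)) \<longlonglongrightarrow> scaleY (a m x) z"
      proof (rule image_tendsto[OF _ \<kappa>])
        show "(\<lambda>k. S k x) \<longlonglongrightarrow> 0"
          using x(1) U(3) assms(14) by (auto simp: S_def)
        show "\<iota> c \<ge> c" for c
          by (simp add: \<iota>_def le_prod_encode_2)
      qed (simp_all add: \<iota>_def b_def y_def t_def j)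
      \<comment> \<open>Since \<open>n k \<ge> 1\<close>, the images under \<open>S\<close> belong
        to the orbit.\<close>
      then show ?thesis
        by (rule Y.tendsto_in_closure) (use assms(9) in \<open>auto simp: S_def\<close>)
    qed
    then have sub: "scaleY (a m x) ` D \<subseteq> closure ?O"
      by blast
    \<comment> \<open>Multiplication by the nonzero scalar \<open>a m x\<close> preserves density of
      \<open>D\<close>: approximate \<open>z\<close> divided by it, then multiply back.\<close>
    have "z \<in> closure ?O" for z
    proof -
      have "scaleY (1 / a m x) z \<in> closure D"
        using D(2) by (simp add: dense_def)
      then obtain v where v: "\<And>i. v i \<in> D" "v \<longlonglongrightarrow> scaleY (1 / a m x) z"
        by (metis Y.in_closure_sequence)
      have "(\<lambda>i. scaleY (a m x) (v i)) \<longlonglongrightarrow> scaleY (a m x) (scaleY (1 / a m x) z)"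
        by (rule Y.tendsto_scale_p[OF v(2)])
      then have "(\<lambda>i. scaleY (a m x) (v i)) \<longlonglongrightarrow> z"
        using m by simp
      then have "z \<in> closure (closure ?O)"
        by (rule Y.tendsto_in_closure) (use sub v(1) in blast)
      then show ?thesis by simp
    qed
    then show ?thesis
      by (auto simp: hypercyclic_vector_def dense_def)
  qed
  \<comment> \<open>A nonzero vector of the image is \<open>R x\<close> with \<open>x\<close>
    nonzero, because \<open>R 0 = 0\<close>.\<close>
  then have "hypercyclic_subspace scaleX T (R ` U)"
    unfolding hypercyclic_subspace_def
    using subspace_R_image[OF U(1)] closed_R_image[OF U(2)] infinite_dimensional_R_image[OF U(4)]
      R_eq_0_iff by blast
  then show ?thesis by blast
qed

end
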